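(* Let $R$ be a Noetherian ring and $n>0$ an integer. Then every chain complex of left $R$-modules in $\mathrm{dw}\widetilde{\mathcal{P}_n}$ has a $\mathrm{dw}\widetilde{\mathcal{P}_n^{\aleph_0}}$-filtration.
   Context: Chain complexes are $\mathbb{Z}$-graded. For a class $\mathcal{A}$ of left $R$-modules, $\mathrm{dw}\widetilde{\mathcal{A}}$ is the class of chain complexes $X$ with $X_m\in\mathcal{A}$ for every $m\in\mathbb{Z}$. $\mathcal{P}_n$ is the class of left $R$-modules of projective dimension at most $n$. $\mathcal{P}_n^{\aleph_0}$ is the set (of representatives) of all left $R$-modules $M$ having an exact sequence $0\to\bigoplus_{i\in I_n}P_n^i\to\cdots\to\bigoplus_{i\in I_0}P_0^i\to M\to 0$ in which every $P_k^i$ is a countably generated projective module and every $I_k$ ($0\leq k\leq n$) is countable. Given a class $\mathcal{S}$ of objects of a cocomplete Abelian category, an $\mathcal{S}$-filtration of an object $X$ is a family $(X_\alpha:\alpha<\lambda)$, $\lambda$ an ordinal, forming a colimit-preserving functor on $\lambda$ (so $X_\beta=\mathrm{CoLim}_{\alpha<\beta}X_\alpha$ for limit ordinals $\beta<\lambda$), with $X=\mathrm{CoLim}_{\alpha<\lambda}X_\alpha$, such that $X_0\in\mathcal{S}$ and for each $\alpha+1<\lambda$ the map $X_\alpha\to X_{\alpha+1}$ is a monomorphism with cokernel in $\mathcal{S}$. *)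

theory Defs
  imports "HOL-Algebra.Ring_Divisibility" "HOL-Library.Countable_Set"
begin

section \<open>Left modules over a not necessarily commutative ring\<close>

text \<open>The locale \<^locale>\<open>module\<close> of HOL-Algebra requires a commutative ring.
  This is the same locale, over a ring.\<close>

locale left_module = R?: ring R + M?: abelian_group M
  for R :: "('a, 'd) ring_scheme" (structure) and M :: "('a, 'b, 'c) module_scheme" (structure) +
  assumes smult_closed [simp, intro]:
      "\<lbrakk>a \<in> carrier R; x \<in> carrier M\<rbrakk> \<Longrightarrow> a \<odot>\<^bsub>M\<^esub> x \<in> carrier M"
    and smult_l_distr:
      "\<lbrakk>a \<in> carrier R; b \<in> carrier R; x \<in> carrier M\<rbrakk> \<Longrightarrow>
        (a \<oplus> b) \<odot>\<^bsub>M\<^esub> x = a \<odot>\<^bsub>M\<^esub> x \<oplus>\<^bsub>M\<^esub> b \<odot>\<^bsub>M\<^esub> x"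
    and smult_r_distr:
      "\<lbrakk>a \<in> carrier R; x \<in> carrier M; y \<in> carrier M\<rbrakk> \<Longrightarrow>
        a \<odot>\<^bsub>M\<^esub> (x \<oplus>\<^bsub>M\<^esub> y) = a \<odot>\<^bsub>M\<^esub> x \<oplus>\<^bsub>M\<^esub> a \<odot>\<^bsub>M\<^esub> y"
    and smult_assoc1:
      "\<lbrakk>a \<in> carrier R; b \<in> carrier R; x \<in> carrier M\<rbrakk> \<Longrightarrow>
        (a \<otimes> b) \<odot>\<^bsub>M\<^esub> x = a \<odot>\<^bsub>M\<^esub> (b \<odot>\<^bsub>M\<^esub> x)"
    and smult_one [simp]: "x \<in> carrier M \<Longrightarrow> \<one> \<odot>\<^bsub>M\<^esub> x = x"

lemma left_module_iff_module:
  assumes "cring R"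
  shows "left_module R M \<longleftrightarrow> module R M"
proof -
  have "ring R" using assms by (rule cring.axioms(1))
  then show ?thesis
    using assms
    by (simp add: left_module_def left_module_axioms_def module_def module_axioms_def)
qed

definition lmod_hom ::
    "'r ring \<Rightarrow> ('r, 'm) module \<Rightarrow> ('r, 'n) module \<Rightarrow> ('m \<Rightarrow> 'n) set" where
  "lmod_hom R M N = {f. f \<in> carrier M \<rightarrow> carrier N \<and>
     (\<forall>x\<in>carrier M. \<forall>y\<in>carrier M. f (x \<oplus>\<^bsub>M\<^esub> y) = f x \<oplus>\<^bsub>N\<^esub> f y) \<and>
     (\<forall>a\<in>carrier R. \<forall>x\<in>carrier M. f (a \<odot>\<^bsub>M\<^esub> x) = a \<odot>\<^bsub>N\<^esub> f x)}"

definition lmod_ker :: "('r, 'm) module \<Rightarrow> ('r, 'n) module \<Rightarrow> ('m \<Rightarrow> 'n) \<Rightarrow> 'm set" where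
  "lmod_ker M N f = {x \<in> carrier M. f x = \<zero>\<^bsub>N\<^esub>}"

definition left_ideal :: "'r set \<Rightarrow> 'r ring \<Rightarrow> bool" where
  "left_ideal J R \<longleftrightarrow> additive_subgroup J R \<and> (\<forall>a\<in>carrier R. \<forall>x\<in>J. a \<otimes>\<^bsub>R\<^esub> x \<in> J)"

text \<open>The locale \<^locale>\<open>noetherian_ring\<close> of HOL-Algebra speaks about two-sided ideals, which is
  the wrong notion over a noncommutative ring.\<close>

definition left_noetherian :: "'r ring \<Rightarrow> bool" where
  "left_noetherian R \<longleftrightarrow> ring R \<and>
     (\<forall>J. left_ideal J R \<longrightarrow>
       (\<exists>A. finite A \<and> A \<subseteq> carrier R \<and> J = (\<lambda>I. left_ideal I R) hull A))"

definition countably_generated :: "'r ring \<Rightarrow> ('r, 'm) module \<Rightarrow> bool" where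
  "countably_generated R M \<longleftrightarrow>
     (\<exists>A. countable A \<and> A \<subseteq> carrier M \<and> carrier M = (\<lambda>N. submodule N R M) hull A)"

text \<open>The lifting property cannot quantify over modules of all types. The two types below lose
  nothing: the free module on the set \<^term>\<open>carrier P\<close> lives on \<^typ>\<open>'p \<Rightarrow> 'r\<close>, and lifting the
  identity of \<^term>\<open>P\<close> along the surjection from this free module makes \<^term>\<open>P\<close> a direct summand
  of it, hence projective against all modules.\<close>

definition projective_lmod :: "'r ring \<Rightarrow> ('r, 'p) module \<Rightarrow> bool" where
  "projective_lmod R P \<longleftrightarrow> left_module R P \<and>
     (\<forall>(N :: ('r, 'p \<Rightarrow> 'r) module) (N' :: ('r, 'p) module) g f.
        left_module R N \<and> left_module R N' \<and>
        g \<in> lmod_hom R N N' \<and> g ` carrier N = carrier N' \<and> f \<in> lmod_hom R P N' \<longrightarrow>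
        (\<exists>h\<in>lmod_hom R P N. \<forall>x\<in>carrier P. g (h x) = f x))"

text \<open>External direct sum. Only the additive and scalar structure of the record matters for a
  module, so its ring multiplication and unit are left \<^term>\<open>undefined\<close>.\<close>

definition lmod_direct_sum :: "'i set \<Rightarrow> ('i \<Rightarrow> ('r, 'm) module) \<Rightarrow> ('r, 'i \<Rightarrow> 'm) module" where
  "lmod_direct_sum I Q =
     \<lparr>carrier = {x \<in> \<Pi>\<^sub>E i\<in>I. carrier (Q i). finite {i \<in> I. x i \<noteq> \<zero>\<^bsub>Q i\<^esub>}},
      monoid.mult = undefined, one = undefined,
      zero = (\<lambda>i\<in>I. \<zero>\<^bsub>Q i\<^esub>),
      add = (\<lambda>x y. \<lambda>i\<in>I. x i \<oplus>\<^bsub>Q i\<^esub> y i),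
      smult = (\<lambda>a x. \<lambda>i\<in>I. a \<odot>\<^bsub>Q i\<^esub> x i)\<rparr>"

text \<open>An exact sequence \<open>0 \<rightarrow> P n \<rightarrow> \<dots> \<rightarrow> P 0 \<rightarrow> M \<rightarrow> 0\<close> with maps \<open>\<epsilon> : P 0 \<rightarrow> M\<close> and
  \<open>d k : P (k + 1) \<rightarrow> P k\<close>, continued to the left by zero modules; thus the last condition at
  \<open>k + 1 = n\<close> says that \<open>d (n - 1)\<close> is injective, and for \<open>n = 0\<close> the condition on \<open>\<epsilon>\<close> says that
  \<open>\<epsilon>\<close> is injective.\<close>

definition exact_resolution ::
    "'r ring \<Rightarrow> nat \<Rightarrow> (nat \<Rightarrow> ('r, 'p) module) \<Rightarrow> (nat \<Rightarrow> 'p \<Rightarrow> 'p) \<Rightarrow> ('p \<Rightarrow> 'm) \<Rightarrow>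
     ('r, 'm) module \<Rightarrow> bool" where
  "exact_resolution R n P d \<epsilon> M \<longleftrightarrow>
     left_module R M \<and> (\<forall>k. left_module R (P k)) \<and> (\<forall>k>n. carrier (P k) = {\<zero>\<^bsub>P k\<^esub>}) \<and>
     \<epsilon> \<in> lmod_hom R (P 0) M \<and> (\<forall>k. d k \<in> lmod_hom R (P (Suc k)) (P k)) \<and>
     \<epsilon> ` carrier (P 0) = carrier M \<and>
     lmod_ker (P 0) M \<epsilon> = d 0 ` carrier (P 1) \<and>
     (\<forall>k. lmod_ker (P (Suc k)) (P k) (d k) = d (Suc k) ` carrier (P (Suc (Suc k))))"

text \<open>The class \<open>\<P>\<^sub>n\<close> of left modules of projective dimension at most \<open>n\<close>, with the type
  of the elements of the projective modules in the resolution as a parameter.\<close>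

definition proj_dim_le :: "'p itself \<Rightarrow> 'r ring \<Rightarrow> nat \<Rightarrow> ('r, 'm) module \<Rightarrow> bool" where
  "proj_dim_le _ R n M \<longleftrightarrow>
     (\<exists>(P :: nat \<Rightarrow> ('r, 'p) module) d \<epsilon>.
        exact_resolution R n P d \<epsilon> M \<and> (\<forall>k\<le>n. projective_lmod R (P k)))"

text \<open>The class \<open>\<P>\<^sub>n\<close> with superscript \<open>\<aleph>\<^sub>0\<close>, closed under isomorphism instead of cut down to a
  set of representatives. A countably generated projective module is a direct summand of the free
  module of countable rank, so up to isomorphism it lives on the type \<^typ>\<open>nat \<Rightarrow> 'r\<close>; countable
  index sets are taken inside \<^typ>\<open>nat\<close>. Indices \<open>k > n\<close> are irrelevant, as
  \<^const>\<open>exact_resolution\<close> forces the module there to be zero.\<close>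

definition proj_dim_le_aleph0 :: "'r ring \<Rightarrow> nat \<Rightarrow> ('r, 'm) module \<Rightarrow> bool" where
  "proj_dim_le_aleph0 R n M \<longleftrightarrow>
     (\<exists>(I :: nat \<Rightarrow> nat set) (Q :: nat \<Rightarrow> nat \<Rightarrow> ('r, nat \<Rightarrow> 'r) module) d \<epsilon>.
        (\<forall>k\<le>n. \<forall>i\<in>I k. projective_lmod R (Q k i) \<and> countably_generated R (Q k i)) \<and>
        exact_resolution R n (\<lambda>k. lmod_direct_sum (I k) (Q k)) d \<epsilon> M)"


section \<open>Chain complexes\<close>

record ('r, 'm) chain_complex =
  term_at :: "int \<Rightarrow> ('r, 'm) module"
  bdry :: "int \<Rightarrow> 'm \<Rightarrow> 'm"

definition chain_complex :: "'r ring \<Rightarrow> ('r, 'm) chain_complex \<Rightarrow> bool" where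
  "chain_complex R X \<longleftrightarrow>
     (\<forall>m. left_module R (term_at X m)) \<and>
     (\<forall>m. bdry X m \<in> lmod_hom R (term_at X m) (term_at X (m - 1))) \<and>
     (\<forall>m. \<forall>x\<in>carrier (term_at X m). bdry X (m - 1) (bdry X m x) = \<zero>\<^bsub>term_at X (m - 2)\<^esub>)"

text \<open>Two families of functions denote the same chain map if they agree on the carriers.\<close>

definition chain_map ::
    "'r ring \<Rightarrow> ('r, 'm) chain_complex \<Rightarrow> ('r, 'n) chain_complex \<Rightarrow> (int \<Rightarrow> 'm \<Rightarrow> 'n) \<Rightarrow> bool" where
  "chain_map R X Y f \<longleftrightarrow>
     (\<forall>m. f m \<in> lmod_hom R (term_at X m) (term_at Y m)) \<and>
     (\<forall>m. \<forall>x\<in>carrier (term_at X m). f (m - 1) (bdry X m x) = bdry Y m (f m x))"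

definition chain_map_eq ::
    "('r, 'm) chain_complex \<Rightarrow> (int \<Rightarrow> 'm \<Rightarrow> 'n) \<Rightarrow> (int \<Rightarrow> 'm \<Rightarrow> 'n) \<Rightarrow> bool" where
  "chain_map_eq X f g \<longleftrightarrow> (\<forall>m. \<forall>x\<in>carrier (term_at X m). f m x = g m x)"

definition short_exact ::
    "'r ring \<Rightarrow> ('r, 'a) chain_complex \<Rightarrow> (int \<Rightarrow> 'a \<Rightarrow> 'b) \<Rightarrow> ('r, 'b) chain_complex \<Rightarrow>
     (int \<Rightarrow> 'b \<Rightarrow> 'c) \<Rightarrow> ('r, 'c) chain_complex \<Rightarrow> bool" where
  "short_exact R X f Y g Z \<longleftrightarrow>
     chain_complex R X \<and> chain_complex R Y \<and> chain_complex R Z \<and>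
     chain_map R X Y f \<and> chain_map R Y Z g \<and>
     (\<forall>m. inj_on (f m) (carrier (term_at X m)) \<and>
          g m ` carrier (term_at Y m) = carrier (term_at Z m) \<and>
          lmod_ker (term_at Y m) (term_at Z m) (g m) = f m ` carrier (term_at X m))"

definition dw ::
    "'r ring \<Rightarrow> (('r, 'm) module \<Rightarrow> bool) \<Rightarrow> ('r, 'm) chain_complex \<Rightarrow> bool" where
  "dw R \<A> X \<longleftrightarrow> chain_complex R X \<and> (\<forall>m. \<A> (term_at X m))"


section \<open>Filtrations\<close>

text \<open>An ordinal is given by a well-order \<open>r\<close>. A cocone is a colimit of the diagram \<open>D, f\<close>, restricted
  to the indices in \<open>A\<close>, if it has the universal property. The cocones against which the universal
  property is tested range over complexes on the type \<^typ>\<open>('i \<times> 'm) set\<close>. This suffices to give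
  the universal property for complexes of every type if \<open>A\<close> is nonempty: the usual construction of
  the colimit as a quotient of the disjoint union of the \<open>D \<alpha>\<close> lives on this type, and so does a
  copy of \<open>X\<close> itself, so that the two are isomorphic.\<close>

definition cocone ::
    "'r ring \<Rightarrow> 'i rel \<Rightarrow> 'i set \<Rightarrow> ('i \<Rightarrow> ('r, 'm) chain_complex) \<Rightarrow>
     ('i \<Rightarrow> 'i \<Rightarrow> int \<Rightarrow> 'm \<Rightarrow> 'm) \<Rightarrow> ('r, 'n) chain_complex \<Rightarrow> ('i \<Rightarrow> int \<Rightarrow> 'm \<Rightarrow> 'n) \<Rightarrow> bool" where
  "cocone R r A D f Y \<phi> \<longleftrightarrow> chain_complex R Y \<and>
     (\<forall>\<alpha>\<in>A. chain_map R (D \<alpha>) Y (\<phi> \<alpha>)) \<and>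
     (\<forall>\<alpha>\<in>A. \<forall>\<beta>\<in>A. (\<alpha>, \<beta>) \<in> r \<longrightarrow>
        chain_map_eq (D \<alpha>) (\<lambda>m x. \<phi> \<beta> m (f \<alpha> \<beta> m x)) (\<phi> \<alpha>))"

definition is_colimit ::
    "'r ring \<Rightarrow> 'i rel \<Rightarrow> 'i set \<Rightarrow> ('i \<Rightarrow> ('r, 'm) chain_complex) \<Rightarrow>
     ('i \<Rightarrow> 'i \<Rightarrow> int \<Rightarrow> 'm \<Rightarrow> 'm) \<Rightarrow> ('r, 'm) chain_complex \<Rightarrow> ('i \<Rightarrow> int \<Rightarrow> 'm \<Rightarrow> 'm) \<Rightarrow> bool" where
  "is_colimit R r A D f X \<iota> \<longleftrightarrow> cocone R r A D f X \<iota> \<and>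
     (\<forall>(Y :: ('r, ('i \<times> 'm) set) chain_complex) \<phi>. cocone R r A D f Y \<phi> \<longrightarrow>
        (\<exists>h. chain_map R X Y h \<and>
             (\<forall>\<alpha>\<in>A. chain_map_eq (D \<alpha>) (\<lambda>m x. h m (\<iota> \<alpha> m x)) (\<phi> \<alpha>)) \<and>
             (\<forall>h'. chain_map R X Y h' \<and>
                   (\<forall>\<alpha>\<in>A. chain_map_eq (D \<alpha>) (\<lambda>m x. h' m (\<iota> \<alpha> m x)) (\<phi> \<alpha>)) \<longrightarrow>
                   chain_map_eq X h h')))"

definition functor_on ::
    "'r ring \<Rightarrow> 'i rel \<Rightarrow> ('i \<Rightarrow> ('r, 'm) chain_complex) \<Rightarrow>
     ('i \<Rightarrow> 'i \<Rightarrow> int \<Rightarrow> 'm \<Rightarrow> 'm) \<Rightarrow> bool" where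
  "functor_on R r D f \<longleftrightarrow>
     (\<forall>\<alpha>\<in>Field r. chain_complex R (D \<alpha>) \<and> chain_map_eq (D \<alpha>) (f \<alpha> \<alpha>) (\<lambda>m x. x)) \<and>
     (\<forall>\<alpha> \<beta>. (\<alpha>, \<beta>) \<in> r \<longrightarrow> chain_map R (D \<alpha>) (D \<beta>) (f \<alpha> \<beta>)) \<and>
     (\<forall>\<alpha> \<beta> \<gamma>. (\<alpha>, \<beta>) \<in> r \<and> (\<beta>, \<gamma>) \<in> r \<longrightarrow>
        chain_map_eq (D \<alpha>) (\<lambda>m x. f \<beta> \<gamma> m (f \<alpha> \<beta> m x)) (f \<alpha> \<gamma>))"

definition is_succ_of :: "'i rel \<Rightarrow> 'i \<Rightarrow> 'i \<Rightarrow> bool" where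
  "is_succ_of r \<alpha> \<beta> \<longleftrightarrow> \<beta> \<in> Field r \<and> \<alpha> \<in> underS r \<beta> \<and> underS r \<beta> = under r \<alpha>"

definition is_filtration ::
    "'r ring \<Rightarrow> (('r, 'm) chain_complex \<Rightarrow> bool) \<Rightarrow> 'i rel \<Rightarrow>
     ('i \<Rightarrow> ('r, 'm) chain_complex) \<Rightarrow> ('i \<Rightarrow> 'i \<Rightarrow> int \<Rightarrow> 'm \<Rightarrow> 'm) \<Rightarrow>
     ('r, 'm) chain_complex \<Rightarrow> ('i \<Rightarrow> int \<Rightarrow> 'm \<Rightarrow> 'm) \<Rightarrow> bool" where
  "is_filtration R S r D f X \<iota> \<longleftrightarrow>
     Well_order r \<and> Field r \<noteq> {} \<and> functor_on R r D f \<and>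
     (\<forall>\<alpha>\<in>Field r. underS r \<alpha> = {} \<longrightarrow> S (D \<alpha>)) \<and>
     (\<forall>\<alpha> \<beta>. is_succ_of r \<alpha> \<beta> \<longrightarrow> (\<exists>C g. S C \<and> short_exact R (D \<alpha>) (f \<alpha> \<beta>) (D \<beta>) g C)) \<and>
     (\<forall>\<beta>\<in>Field r. underS r \<beta> \<noteq> {} \<and> (\<nexists>\<alpha>. is_succ_of r \<alpha> \<beta>) \<longrightarrow>
        is_colimit R r (underS r \<beta>) D f (D \<beta>) (\<lambda>\<alpha>. f \<alpha> \<beta>)) \<and>
     is_colimit R r (Field r) D f X \<iota>"

text \<open>The types are no restriction. In a filtration of \<open>X\<close> all maps to \<open>X\<close> are injective, so the
  stages and the cokernels have copies on the type of the elements of \<open>X\<close>. Repetitions can be left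
  out, and then each index that has a successor can be replaced by a nonzero element of some
  \<open>X\<^sub>m\<close> that is new at that successor, and a last index by a zero element.\<close>

definition has_filtration ::
    "'r ring \<Rightarrow> (('r, 'm) chain_complex \<Rightarrow> bool) \<Rightarrow> ('r, 'm) chain_complex \<Rightarrow> bool" where
  "has_filtration R S X \<longleftrightarrow> (\<exists>(r :: (int \<times> 'm) rel) D f \<iota>. is_filtration R S r D f X \<iota>)"

end

theory Submission
  imports Defs
begin

text \<open>A projective module \<open>P\<close> has a dual basis: forms \<open>\<phi> b\<close>, indexed by the elements \<open>b\<close> of \<open>P\<close>,
  with \<open>x = (\<Sum>b. \<phi> b x b)\<close>. Call a set \<open>J\<close> of indices closed if it contains the support of each of its
  members; then the elements of \<open>P\<close> with support in \<open>J\<close> form a submodule, and for closed sets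
  \<open>J \<subseteq> K\<close> with \<open>K - J\<close> countable the quotient of these submodules has a countable dual basis, so it
  is again projective. This takes the place of Kaplansky's theorem.

  Resolve all terms of the complex \<open>X\<close> and let \<open>J\<close> select indices in all projectives at once. If
  \<open>J\<close> is also closed under the supports of the images under the differentials of the resolutions
  and of lifts of the boundary of \<open>X\<close>, then it determines a subcomplex of \<open>X\<close>; if moreover the
  selected parts of the resolutions are still exact, call \<open>J\<close> good. The failure of exactness that
  arises on adding countably many indices to a good \<open>J\<close> is countably generated modulo \<open>J\<close>, because
  \<open>R\<close> is left Noetherian. Hence it is repaired by countably many further indices, and after
  \<open>\<omega>\<close> rounds one has a good set again. Unions of chains of good sets are good, so transfinite
  iteration exhausts \<open>X\<close>, with successive quotients in the required class.\<close>

section \<open>Left modules\<close>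

context left_module
begin

lemma smult_l_null [simp]: "x \<in> carrier M \<Longrightarrow> \<zero> \<odot>\<^bsub>M\<^esub> x = \<zero>\<^bsub>M\<^esub>"
  using smult_l_distr[of \<zero> \<zero> x] M.add.r_cancel_one'[of "\<zero> \<odot>\<^bsub>M\<^esub> x" "\<zero> \<odot>\<^bsub>M\<^esub> x"] by auto

lemma smult_r_null [simp]: "a \<in> carrier R \<Longrightarrow> a \<odot>\<^bsub>M\<^esub> \<zero>\<^bsub>M\<^esub> = \<zero>\<^bsub>M\<^esub>"
  using smult_r_distr[of a "\<zero>\<^bsub>M\<^esub>" "\<zero>\<^bsub>M\<^esub>"]
    M.add.r_cancel_one'[of "a \<odot>\<^bsub>M\<^esub> \<zero>\<^bsub>M\<^esub>" "a \<odot>\<^bsub>M\<^esub> \<zero>\<^bsub>M\<^esub>"] by auto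

lemma minus_one_smult: "x \<in> carrier M \<Longrightarrow> (\<ominus> \<one>) \<odot>\<^bsub>M\<^esub> x = \<ominus>\<^bsub>M\<^esub> x"
  using smult_l_distr[of "\<ominus> \<one>" \<one> x] by (simp add: R.l_neg M.add.inv_equality)

lemma diff_self: "x \<in> carrier M \<Longrightarrow> x \<ominus>\<^bsub>M\<^esub> x = \<zero>\<^bsub>M\<^esub>"
  by (simp add: a_minus_def M.r_neg)

lemma diff_zero: "x \<in> carrier M \<Longrightarrow> x \<ominus>\<^bsub>M\<^esub> \<zero>\<^bsub>M\<^esub> = x"
  using M.r_neg[of "\<zero>\<^bsub>M\<^esub>"] by (simp add: a_minus_def)

lemma eq_if_diff_zero:
  "x \<in> carrier M \<Longrightarrow> y \<in> carrier M \<Longrightarrow> x \<ominus>\<^bsub>M\<^esub> y = \<zero>\<^bsub>M\<^esub> \<Longrightarrow> x = y"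
  using M.minus_equality[of x "\<ominus>\<^bsub>M\<^esub> y"] by (simp add: a_minus_def)

text \<open>Closure under negatives comes from multiplication with the scalar -1.\<close>

lemma submoduleI:
  assumes "H \<subseteq> carrier M" "\<zero>\<^bsub>M\<^esub> \<in> H"
    and "\<And>x y. x \<in> H \<Longrightarrow> y \<in> H \<Longrightarrow> x \<oplus>\<^bsub>M\<^esub> y \<in> H"
    and "\<And>a x. a \<in> carrier R \<Longrightarrow> x \<in> H \<Longrightarrow> a \<odot>\<^bsub>M\<^esub> x \<in> H"
  shows "submodule H R M"
proof -
  have "\<ominus>\<^bsub>M\<^esub> x \<in> H" if "x \<in> H" for x
    using assms(4)[of "\<ominus> \<one>" x] minus_one_smult[of x] assms(1) that by auto
  then show ?thesis
    using assms by unfold_locales (auto simp: a_inv_def)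
qed

lemma submodule_minus:
  assumes "submodule H R M" "x \<in> H" "y \<in> H"
  shows "x \<ominus>\<^bsub>M\<^esub> y \<in> H"
proof -
  interpret H: submodule H R M by fact
  show ?thesis
    using assms(2,3) H.m_closed H.m_inv_closed by (auto simp: a_minus_def a_inv_def)
qed

lemma finsum_in_submodule:
  assumes "submodule H R M" "f \<in> A \<rightarrow> H"
  shows "finsum M f A \<in> H"
proof -
  interpret H: submodule H R M by fact
  have z: "\<zero>\<^bsub>M\<^esub> \<in> H" using H.one_closed by simp
  have sub: "H \<subseteq> carrier M" using H.subset by simp
  show ?thesis
    using assms(2)
  proof (induction A rule: infinite_finite_induct)
    case (insert a A)
    then show ?case
      using H.m_closed[of "f a" "finsum M f A"] sub
      by (subst finsum_insert) (auto simp: Pi_iff subset_iff)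
  qed (use z in \<open>auto simp: finsum_infinite\<close>)
qed

lemma smult_finsum:
  assumes "a \<in> carrier R" and "g \<in> A \<rightarrow> carrier M"
  shows "a \<odot>\<^bsub>M\<^esub> finsum M g A = finsum M (\<lambda>i. a \<odot>\<^bsub>M\<^esub> g i) A"
  using assms(2)
proof (induction A rule: infinite_finite_induct)
  case (insert b A)
  then have "finsum M g A \<in> carrier M" by (auto intro: finsum_closed)
  then show ?case
    using insert assms(1) by (simp add: finsum_insert smult_r_distr Pi_iff)
qed (use assms(1) in \<open>simp_all add: finsum_infinite\<close>)

end

section \<open>Submodules, recognition of modules, homomorphisms\<close>

lemma submodule_carrier: "submodule H R M \<Longrightarrow> x \<in> H \<Longrightarrow> x \<in> carrier M"
  using submodule.axioms(1) subgroup.subset by fastforce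

lemma submodule_zero: "submodule H R M \<Longrightarrow> \<zero>\<^bsub>M\<^esub> \<in> H"
  using submodule.axioms(1) subgroup.one_closed by fastforce

lemma submodule_add: "submodule H R M \<Longrightarrow> x \<in> H \<Longrightarrow> y \<in> H \<Longrightarrow> x \<oplus>\<^bsub>M\<^esub> y \<in> H"
  using submodule.axioms(1) subgroup.m_closed by fastforce

lemmas submodule_smult = submodule.smult_closed

text \<open>Instead of additive inverses only the equation
  \<open>\<zero> \<odot> x = \<zero>\<close> is asked for: with it, distributivity makes (-1) x an
  inverse of x. All remaining conditions are closure properties and equations, which are easy to
  transport.\<close>

lemma left_moduleI:
  fixes R (structure) and M (structure)
  assumes "ring R"
    and "\<And>x y. x \<in> carrier M \<Longrightarrow> y \<in> carrier M \<Longrightarrow> x \<oplus>\<^bsub>M\<^esub> y \<in> carrier M"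
    and "\<zero>\<^bsub>M\<^esub> \<in> carrier M"
    and "\<And>x y z. x \<in> carrier M \<Longrightarrow> y \<in> carrier M \<Longrightarrow> z \<in> carrier M \<Longrightarrow>
      (x \<oplus>\<^bsub>M\<^esub> y) \<oplus>\<^bsub>M\<^esub> z = x \<oplus>\<^bsub>M\<^esub> (y \<oplus>\<^bsub>M\<^esub> z)"
    and "\<And>x y. x \<in> carrier M \<Longrightarrow> y \<in> carrier M \<Longrightarrow> x \<oplus>\<^bsub>M\<^esub> y = y \<oplus>\<^bsub>M\<^esub> x"
    and "\<And>x. x \<in> carrier M \<Longrightarrow> \<zero>\<^bsub>M\<^esub> \<oplus>\<^bsub>M\<^esub> x = x"
    and "\<And>x. x \<in> carrier M \<Longrightarrow> \<zero> \<odot>\<^bsub>M\<^esub> x = \<zero>\<^bsub>M\<^esub>"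
    and "\<And>a x. a \<in> carrier R \<Longrightarrow> x \<in> carrier M \<Longrightarrow> a \<odot>\<^bsub>M\<^esub> x \<in> carrier M"
    and "\<And>a b x. a \<in> carrier R \<Longrightarrow> b \<in> carrier R \<Longrightarrow> x \<in> carrier M \<Longrightarrow>
      (a \<oplus> b) \<odot>\<^bsub>M\<^esub> x = a \<odot>\<^bsub>M\<^esub> x \<oplus>\<^bsub>M\<^esub> b \<odot>\<^bsub>M\<^esub> x"
    and "\<And>a x y. a \<in> carrier R \<Longrightarrow> x \<in> carrier M \<Longrightarrow> y \<in> carrier M \<Longrightarrow>
      a \<odot>\<^bsub>M\<^esub> (x \<oplus>\<^bsub>M\<^esub> y) = a \<odot>\<^bsub>M\<^esub> x \<oplus>\<^bsub>M\<^esub> a \<odot>\<^bsub>M\<^esub> y"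
    and "\<And>a b x. a \<in> carrier R \<Longrightarrow> b \<in> carrier R \<Longrightarrow> x \<in> carrier M \<Longrightarrow>
      (a \<otimes> b) \<odot>\<^bsub>M\<^esub> x = a \<odot>\<^bsub>M\<^esub> (b \<odot>\<^bsub>M\<^esub> x)"
    and "\<And>x. x \<in> carrier M \<Longrightarrow> \<one> \<odot>\<^bsub>M\<^esub> x = x"
  shows "left_module R M"
proof -
  interpret R: ring R by fact
  have "\<exists>y\<in>carrier M. y \<oplus>\<^bsub>M\<^esub> x = \<zero>\<^bsub>M\<^esub>" if "x \<in> carrier M" for x
    using that assms(7-9,12) assms(9)[of "\<ominus> \<one>" \<one> x]
    by (intro bexI[of _ "(\<ominus> \<one>) \<odot>\<^bsub>M\<^esub> x"]) (auto simp: R.l_neg)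
  then have "abelian_group M"
    using assms by (intro abelian_groupI) auto
  then show ?thesis
    using assms by (intro left_module.intro left_module_axioms.intro) auto
qed

text \<open>Module axioms are equations, so they pass along any surjection that respects the
  operations. \<open>N\<close> is only a record at first; coordinate modules, quotients and direct
  sums are recognised as modules in this way.\<close>

lemma left_module_image:
  assumes "left_module R M" and "p ` carrier M = carrier N"
    and "\<And>x y. x \<in> carrier M \<Longrightarrow> y \<in> carrier M \<Longrightarrow> p (x \<oplus>\<^bsub>M\<^esub> y) = p x \<oplus>\<^bsub>N\<^esub> p y"
    and "\<And>a x. a \<in> carrier R \<Longrightarrow> x \<in> carrier M \<Longrightarrow> p (a \<odot>\<^bsub>M\<^esub> x) = a \<odot>\<^bsub>N\<^esub> p x"
    and "p \<zero>\<^bsub>M\<^esub> = \<zero>\<^bsub>N\<^esub>"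
  shows "left_module R N" and "p \<in> lmod_hom R M N"
proof -
  interpret M: left_module R M by fact
  note eqs = assms(3-5)[symmetric]
  have comm: "p (x \<oplus>\<^bsub>M\<^esub> y) = p (y \<oplus>\<^bsub>M\<^esub> x)" if "x \<in> carrier M" "y \<in> carrier M" for x y
    using that by (simp add: M.M.a_comm)
  show "left_module R N"
    by (rule left_moduleI)
      (auto simp: assms(2)[symmetric] eqs M.R.ring_axioms M.M.a_assoc M.smult_l_distr
        M.smult_r_distr M.smult_assoc1 intro: comm)
  show "p \<in> lmod_hom R M N"
    using assms(2-4) by (auto simp: lmod_hom_def)
qed

lemma left_module_restrict:
  fixes R :: "'r ring" and M :: "('r, 'm) module"
  assumes "left_module R M" and "submodule H R M"
  shows "left_module R (M\<lparr>carrier := H\<rparr>)"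
proof -
  interpret M: left_module R M by fact
  note [simp] = submodule_carrier[OF assms(2)] submodule_zero[OF assms(2)]
    submodule_add[OF assms(2)] submodule_smult[OF assms(2)]
  show ?thesis
    by (rule left_moduleI)
      (auto simp: M.R.ring_axioms M.M.a_assoc M.smult_l_distr
        M.smult_r_distr M.smult_assoc1 intro: M.M.a_comm)
qed

lemma lmod_hom_closed: "f \<in> lmod_hom R M N \<Longrightarrow> x \<in> carrier M \<Longrightarrow> f x \<in> carrier N"
  by (auto simp: lmod_hom_def)

lemma lmod_hom_add:
  "f \<in> lmod_hom R M N \<Longrightarrow> x \<in> carrier M \<Longrightarrow> y \<in> carrier M \<Longrightarrow> f (x \<oplus>\<^bsub>M\<^esub> y) = f x \<oplus>\<^bsub>N\<^esub> f y"
  by (auto simp: lmod_hom_def)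

lemma lmod_hom_smult:
  "f \<in> lmod_hom R M N \<Longrightarrow> a \<in> carrier R \<Longrightarrow> x \<in> carrier M \<Longrightarrow> f (a \<odot>\<^bsub>M\<^esub> x) = a \<odot>\<^bsub>N\<^esub> f x"
  by (auto simp: lmod_hom_def)

lemma lmod_homI:
  assumes "\<And>x. x \<in> carrier M \<Longrightarrow> f x \<in> carrier N"
    and "\<And>x y. x \<in> carrier M \<Longrightarrow> y \<in> carrier M \<Longrightarrow> f (x \<oplus>\<^bsub>M\<^esub> y) = f x \<oplus>\<^bsub>N\<^esub> f y"
    and "\<And>a x. a \<in> carrier R \<Longrightarrow> x \<in> carrier M \<Longrightarrow> f (a \<odot>\<^bsub>M\<^esub> x) = a \<odot>\<^bsub>N\<^esub> f x"
  shows "f \<in> lmod_hom R M N"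
  using assms by (auto simp: lmod_hom_def)

lemma lmod_hom_comp:
  "f \<in> lmod_hom R M N \<Longrightarrow> g \<in> lmod_hom R N L \<Longrightarrow> (\<lambda>x. g (f x)) \<in> lmod_hom R M L"
  by (auto simp: lmod_hom_def Pi_iff)

lemma lmod_hom_restrict:
  assumes "f \<in> lmod_hom R M N" and "H \<subseteq> carrier M" and "f ` H \<subseteq> K"
  shows "f \<in> lmod_hom R (M\<lparr>carrier := H\<rparr>) (N\<lparr>carrier := K\<rparr>)"
  using assms by (auto simp: lmod_hom_def Pi_iff subset_iff)

locale lmod_hom_pair = M: left_module R M + N: left_module R N
  for R :: "'r ring" and M :: "('r, 'm) module" and N :: "('r, 'n) module" +
  fixes f
  assumes hom: "f \<in> lmod_hom R M N"
begin

lemmas closed [simp] = lmod_hom_closed[OF hom]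
lemmas add = lmod_hom_add[OF hom]
lemmas smult = lmod_hom_smult[OF hom]

lemma zero [simp]: "f \<zero>\<^bsub>M\<^esub> = \<zero>\<^bsub>N\<^esub>"
  using add[of "\<zero>\<^bsub>M\<^esub>" "\<zero>\<^bsub>M\<^esub>"]
    N.M.add.r_cancel_one'[of "f \<zero>\<^bsub>M\<^esub>" "f \<zero>\<^bsub>M\<^esub>"] by simp

lemma minus: "x \<in> carrier M \<Longrightarrow> y \<in> carrier M \<Longrightarrow> f (x \<ominus>\<^bsub>M\<^esub> y) = f x \<ominus>\<^bsub>N\<^esub> f y"
  using M.minus_one_smult[of y] N.minus_one_smult[of "f y"] smult[of "\<ominus>\<^bsub>R\<^esub> \<one>\<^bsub>R\<^esub>" y]
  by (simp add: a_minus_def add)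

lemma finsum:
  assumes "g \<in> A \<rightarrow> carrier M"
  shows "f (finsum M g A) = finsum N (\<lambda>i. f (g i)) A"
  using assms
proof (induction A rule: infinite_finite_induct)
  case (insert a A)
  then show ?case
    by (subst M.finsum_insert, auto, subst N.finsum_insert, auto simp: add Pi_iff)
qed (auto simp: M.finsum_infinite N.finsum_infinite)

lemma submodule_image:
  assumes "submodule H R M"
  shows "submodule (f ` H) R N"
proof (rule N.submoduleI)
  note sub = submodule_carrier[OF assms]
  show "f ` H \<subseteq> carrier N" using sub by auto
  show "\<zero>\<^bsub>N\<^esub> \<in> f ` H" using submodule_zero[OF assms] zero by (metis imageI)
  show "x \<oplus>\<^bsub>N\<^esub> y \<in> f ` H" if "x \<in> f ` H" "y \<in> f ` H" for x y
    using that sub submodule_add[OF assms] by (auto simp: add[symmetric])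
  show "a \<odot>\<^bsub>N\<^esub> x \<in> f ` H" if "a \<in> carrier R" "x \<in> f ` H" for a x
    using that sub submodule_smult[OF assms] by (auto simp: smult[symmetric])
qed

lemma submodule_vimage:
  assumes "submodule K R N"
  shows "submodule {x \<in> carrier M. f x \<in> K} R M"
  using submodule_zero[OF assms] submodule_add[OF assms] submodule_smult[OF assms]
  by (intro M.submoduleI) (auto simp: add smult)

end

lemma lmod_hom_pairI:
  "left_module R M \<Longrightarrow> left_module R N \<Longrightarrow> f \<in> lmod_hom R M N \<Longrightarrow> lmod_hom_pair R M N f"
  by (simp add: lmod_hom_pair_def lmod_hom_pair_axioms_def)

lemma submodule_Int:
  assumes "left_module R M" and "submodule H R M" and "submodule K R M"
  shows "submodule (H \<inter> K) R M"
  using assms submodule_carrier[OF assms(2)] submodule_zero[OF assms(2)]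
    submodule_add[OF assms(2)] submodule_smult[OF assms(2)]
    submodule_zero[OF assms(3)] submodule_add[OF assms(3)] submodule_smult[OF assms(3)]
  by (intro left_module.submoduleI) auto

lemma submodule_hull:
  assumes "left_module R M" and "A \<subseteq> carrier M"
  shows "submodule ((\<lambda>N. submodule N R M) hull A) R M"
proof (rule left_module.submoduleI[OF assms(1)])
  interpret M: left_module R M by fact
  have "submodule (carrier M) R M" by (rule M.submoduleI) auto
  then show "(\<lambda>N. submodule N R M) hull A \<subseteq> carrier M"
    using assms(2) by (intro hull_minimal)
qed (auto simp: hull_def submodule_zero submodule_add submodule_smult)

section \<open>Dual bases\<close>

definition regular_module :: "'r ring \<Rightarrow> ('r, 'r) module" where
  "regular_module R = \<lparr>carrier = carrier R, monoid.mult = undefined, one = undefined,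
     zero = \<zero>\<^bsub>R\<^esub>, add = add R, smult = monoid.mult R\<rparr>"

lemma regular_module_simps [simp]:
  "carrier (regular_module R) = carrier R" "\<zero>\<^bsub>regular_module R\<^esub> = \<zero>\<^bsub>R\<^esub>"
  "x \<oplus>\<^bsub>regular_module R\<^esub> y = x \<oplus>\<^bsub>R\<^esub> y" "a \<odot>\<^bsub>regular_module R\<^esub> x = a \<otimes>\<^bsub>R\<^esub> x"
  by (simp_all add: regular_module_def)

lemma left_module_regular:
  assumes "ring R"
  shows "left_module R (regular_module R)"
proof -
  interpret ring R by fact
  show ?thesis
    by (rule left_moduleI) (auto simp: assms a_assoc l_distr r_distr m_assoc intro: a_comm)
qed

text \<open>The notion from the dual basis lemma for projective modules: the \<open>q i\<close>
  generate but may be linearly dependent. The sum runs over the support because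
  \<open>finsum\<close> over an infinite set is only a default value.\<close>

definition dual_basis ::
    "'r ring \<Rightarrow> ('r, 'm) module \<Rightarrow> 'i set \<Rightarrow> ('i \<Rightarrow> 'm) \<Rightarrow> ('i \<Rightarrow> 'm \<Rightarrow> 'r) \<Rightarrow> bool" where
  "dual_basis R M I q \<phi> \<longleftrightarrow>
     (\<forall>i\<in>I. q i \<in> carrier M \<and> \<phi> i \<in> lmod_hom R M (regular_module R)) \<and>
     (\<forall>x\<in>carrier M. finite {i \<in> I. \<phi> i x \<noteq> \<zero>\<^bsub>R\<^esub>} \<and>
        x = finsum M (\<lambda>i. \<phi> i x \<odot>\<^bsub>M\<^esub> q i) {i \<in> I. \<phi> i x \<noteq> \<zero>\<^bsub>R\<^esub>})"

locale dual_basis_module = left_module R M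
  for R :: "'r ring" (structure) and M :: "('r, 'm) module" (structure) +
  fixes I :: "'i set" and q :: "'i \<Rightarrow> 'm" and \<phi> :: "'i \<Rightarrow> 'm \<Rightarrow> 'r"
  assumes basis: "dual_basis R M I q \<phi>"
begin

lemma q_closed [simp]: "i \<in> I \<Longrightarrow> q i \<in> carrier M"
  using basis by (auto simp: dual_basis_def)

lemma form_hom: "i \<in> I \<Longrightarrow> \<phi> i \<in> lmod_hom R M (regular_module R)"
  using basis by (auto simp: dual_basis_def)

lemma form_pair: "i \<in> I \<Longrightarrow> lmod_hom_pair R M (regular_module R) (\<phi> i)"
  by (intro lmod_hom_pairI form_hom left_module_regular left_module_axioms R.ring_axioms)

lemma form_closed [simp]: "i \<in> I \<Longrightarrow> x \<in> carrier M \<Longrightarrow> \<phi> i x \<in> carrier R"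
  using lmod_hom_closed[OF form_hom] by fastforce

lemma form_zero [simp]: "i \<in> I \<Longrightarrow> \<phi> i \<zero>\<^bsub>M\<^esub> = \<zero>"
  using lmod_hom_pair.zero[OF form_pair] by simp

lemma form_add:
  "i \<in> I \<Longrightarrow> x \<in> carrier M \<Longrightarrow> y \<in> carrier M \<Longrightarrow> \<phi> i (x \<oplus>\<^bsub>M\<^esub> y) = \<phi> i x \<oplus> \<phi> i y"
  using lmod_hom_add[OF form_hom] by fastforce

lemma form_smult:
  "i \<in> I \<Longrightarrow> a \<in> carrier R \<Longrightarrow> x \<in> carrier M \<Longrightarrow> \<phi> i (a \<odot>\<^bsub>M\<^esub> x) = a \<otimes> \<phi> i x"
  using lmod_hom_smult[OF form_hom] by fastforce

lemma finite_support [simp]: "x \<in> carrier M \<Longrightarrow> finite {i \<in> I. \<phi> i x \<noteq> \<zero>}"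
  using basis by (auto simp: dual_basis_def)

lemma expansion:
  "x \<in> carrier M \<Longrightarrow> finsum M (\<lambda>i. \<phi> i x \<odot>\<^bsub>M\<^esub> q i) {i \<in> I. \<phi> i x \<noteq> \<zero>} = x"
  using basis by (auto simp: dual_basis_def)

lemma in_submodule_if_support:
  assumes "submodule H R M" and "x \<in> carrier M" and "\<And>i. i \<in> I \<Longrightarrow> \<phi> i x \<noteq> \<zero> \<Longrightarrow> q i \<in> H"
  shows "x \<in> H"
  using finsum_in_submodule[OF assms(1), of "\<lambda>i. \<phi> i x \<odot>\<^bsub>M\<^esub> q i" "{i \<in> I. \<phi> i x \<noteq> \<zero>}"]
    expansion[OF assms(2)] assms submodule_smult[OF assms(1)] by auto

lemma countably_generated:
  assumes "countable I"
  shows "countably_generated R M"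
  unfolding countably_generated_def
proof (intro exI conjI)
  show "countable (q ` I)" using assms by simp
  show sub: "q ` I \<subseteq> carrier M" by auto
  let ?H = "(\<lambda>N. submodule N R M) hull (q ` I)"
  have H: "submodule ?H R M"
    using submodule_hull[OF left_module_axioms sub] .
  show "carrier M = ?H"
  proof (intro equalityI subsetI)
    fix x assume "x \<in> carrier M"
    then show "x \<in> ?H"
      by (rule in_submodule_if_support[OF H]) (auto intro: hull_inc)
  qed (rule submodule_carrier[OF H])
qed

text \<open>The \<open>y i\<close> are arbitrary even if the \<open>q i\<close> satisfy relations,
  since the coordinates \<open>\<phi> i x\<close> are determined by \<open>x\<close>. In return the
  map need not send \<open>q i\<close> to \<open>y i\<close>.\<close>

lemma extension:
  fixes N :: "('r, 'n) module"
  assumes "left_module R N" and y: "\<And>i. i \<in> I \<Longrightarrow> y i \<in> carrier N"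
  shows "(\<lambda>x. finsum N (\<lambda>i. \<phi> i x \<odot>\<^bsub>N\<^esub> y i) {i \<in> I. \<phi> i x \<noteq> \<zero>}) \<in> lmod_hom R M N"
    (is "?h \<in> _")
proof -
  interpret N: left_module R N by fact
  \<comment> \<open>The support may be enlarged to any finite set of indices, as the new terms
    vanish. So \<open>x\<close>, \<open>z\<close> and their sum can be treated over one common
    set.\<close>
  have h: "?h x = finsum N (\<lambda>i. \<phi> i x \<odot>\<^bsub>N\<^esub> y i) A"
    if "x \<in> carrier M" "finite A" "{i \<in> I. \<phi> i x \<noteq> \<zero>} \<subseteq> A" "A \<subseteq> I" for x A
    using that y by (intro N.add.finprod_mono_neutral_cong_left) auto
  let ?S = "\<lambda>x. {i \<in> I. \<phi> i x \<noteq> \<zero>}"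
  show ?thesis
  proof (rule lmod_homI)
    show "?h x \<in> carrier N" if "x \<in> carrier M" for x
      using that y by (intro N.finsum_closed) auto
  next
    fix x z assume x: "x \<in> carrier M" and z: "z \<in> carrier M"
    have sub: "?S (x \<oplus>\<^bsub>M\<^esub> z) \<subseteq> ?S x \<union> ?S z"
      using x z by (auto simp: form_add)
    have "?h (x \<oplus>\<^bsub>M\<^esub> z) = finsum N (\<lambda>i. \<phi> i (x \<oplus>\<^bsub>M\<^esub> z) \<odot>\<^bsub>N\<^esub> y i) (?S x \<union> ?S z)"
      using x z sub by (intro h) auto
    also have "\<dots> = finsum N (\<lambda>i. \<phi> i x \<odot>\<^bsub>N\<^esub> y i \<oplus>\<^bsub>N\<^esub> \<phi> i z \<odot>\<^bsub>N\<^esub> y i) (?S x \<union> ?S z)"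
      using x z y by (intro N.finsum_cong') (auto simp: form_add N.smult_l_distr)
    also have "\<dots> = finsum N (\<lambda>i. \<phi> i x \<odot>\<^bsub>N\<^esub> y i) (?S x \<union> ?S z) \<oplus>\<^bsub>N\<^esub>
        finsum N (\<lambda>i. \<phi> i z \<odot>\<^bsub>N\<^esub> y i) (?S x \<union> ?S z)"
      using x z y by (intro N.finsum_addf) auto
    also have "\<dots> = ?h x \<oplus>\<^bsub>N\<^esub> ?h z"
      using x z h[of x "?S x \<union> ?S z"] h[of z "?S x \<union> ?S z"] by auto
    finally show "?h (x \<oplus>\<^bsub>M\<^esub> z) = ?h x \<oplus>\<^bsub>N\<^esub> ?h z" .
  next
    fix a x assume a: "a \<in> carrier R" and x: "x \<in> carrier M"
    have "a \<odot>\<^bsub>N\<^esub> ?h x = finsum N (\<lambda>i. a \<odot>\<^bsub>N\<^esub> (\<phi> i x \<odot>\<^bsub>N\<^esub> y i)) (?S x)"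
      using x y a by (intro N.smult_finsum) auto
    also have "\<dots> = finsum N (\<lambda>i. \<phi> i (a \<odot>\<^bsub>M\<^esub> x) \<odot>\<^bsub>N\<^esub> y i) (?S x)"
      using x y a by (intro N.finsum_cong') (auto simp: form_smult N.smult_assoc1)
    also have "\<dots> = ?h (a \<odot>\<^bsub>M\<^esub> x)"
      using x a by (intro h[symmetric]) (auto simp: form_smult)
    finally show "?h (a \<odot>\<^bsub>M\<^esub> x) = a \<odot>\<^bsub>N\<^esub> ?h x" by simp
  qed
qed

lemma hom_expansion:
  fixes N :: "('r, 'n) module"
  assumes "left_module R N" and "f \<in> lmod_hom R M N" and "x \<in> carrier M"
  shows "f x = finsum N (\<lambda>i. \<phi> i x \<odot>\<^bsub>N\<^esub> f (q i)) {i \<in> I. \<phi> i x \<noteq> \<zero>}"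
proof -
  interpret f: lmod_hom_pair R M N f
    using assms left_module_axioms by (intro lmod_hom_pairI)
  have "f x = finsum N (\<lambda>i. f (\<phi> i x \<odot>\<^bsub>M\<^esub> q i)) {i \<in> I. \<phi> i x \<noteq> \<zero>}"
    using f.finsum[of "\<lambda>i. \<phi> i x \<odot>\<^bsub>M\<^esub> q i" "{i \<in> I. \<phi> i x \<noteq> \<zero>}"] assms(3)
    by (auto simp: expansion)
  also have "\<dots> = finsum N (\<lambda>i. \<phi> i x \<odot>\<^bsub>N\<^esub> f (q i)) {i \<in> I. \<phi> i x \<noteq> \<zero>}"
    using assms(3) by (intro f.N.finsum_cong') (auto simp: f.smult)
  finally show ?thesis .
qed

text \<open>One half of the dual basis lemma. Lift the values \<open>f (q i)\<close> along
  \<open>g\<close> and extend by coordinates; after applying \<open>g\<close> this is the expansion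
  of \<open>f\<close> given by \<open>hom_expansion\<close>.\<close>

lemma projective: "projective_lmod R M"
  unfolding projective_lmod_def
proof (intro conjI allI impI)
  show "left_module R M" by (fact left_module_axioms)
next
  fix N :: "('r, 'm \<Rightarrow> 'r) module" and N' :: "('r, 'm) module" and g f
  assume "left_module R N \<and> left_module R N' \<and> g \<in> lmod_hom R N N' \<and>
    g ` carrier N = carrier N' \<and> f \<in> lmod_hom R M N'"
  then have N: "left_module R N" and N': "left_module R N'" and g: "g \<in> lmod_hom R N N'"
    and surj: "g ` carrier N = carrier N'" and f: "f \<in> lmod_hom R M N'"
    by auto
  have "\<exists>z\<in>carrier N. g z = f (q i)" if "i \<in> I" for i
    using lmod_hom_closed[OF f q_closed[OF that]] surj by (metis imageE)
  then obtain y where y: "\<And>i. i \<in> I \<Longrightarrow> y i \<in> carrier N" "\<And>i. i \<in> I \<Longrightarrow> g (y i) = f (q i)"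
    by metis
  interpret g: lmod_hom_pair R N N' g using N N' g by (rule lmod_hom_pairI)
  let ?h = "\<lambda>x. finsum N (\<lambda>i. \<phi> i x \<odot>\<^bsub>N\<^esub> y i) {i \<in> I. \<phi> i x \<noteq> \<zero>}"
  have "g (?h x) = f x" if x: "x \<in> carrier M" for x
  proof -
    have "g (?h x) = finsum N' (\<lambda>i. g (\<phi> i x \<odot>\<^bsub>N\<^esub> y i)) {i \<in> I. \<phi> i x \<noteq> \<zero>}"
      using x y by (intro g.finsum) auto
    also have "\<dots> = finsum N' (\<lambda>i. \<phi> i x \<odot>\<^bsub>N'\<^esub> f (q i)) {i \<in> I. \<phi> i x \<noteq> \<zero>}"
      using x y lmod_hom_closed[OF f] by (intro g.N.finsum_cong') (auto simp: g.smult)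
    finally show ?thesis using hom_expansion[OF N' f x] by simp
  qed
  then show "\<exists>h\<in>lmod_hom R M N. \<forall>x\<in>carrier M. g (h x) = f x"
    by (intro bexI[OF _ extension[OF N y(1)]]) auto
qed

end

section \<open>Free modules and the dual basis of a projective module\<close>

lemma dual_basis_moduleI: "left_module R M \<Longrightarrow> dual_basis R M I q \<phi> \<Longrightarrow> dual_basis_module R M I q \<phi>"
  by (simp add: dual_basis_module_def dual_basis_module_axioms_def)

text \<open>Functions are zero outside \<open>I\<close>, so the operations are pointwise without
  restriction to \<open>I\<close>. For \<open>I = carrier P\<close> the type is the one against
  which \<open>projective_lmod\<close> tests lifting.\<close>

definition free_module :: "'r ring \<Rightarrow> 'i set \<Rightarrow> ('r, 'i \<Rightarrow> 'r) module" where
  "free_module R I = \<lparr>carrier = {u. (\<forall>i. u i \<in> carrier R) \<and> finite {i. u i \<noteq> \<zero>\<^bsub>R\<^esub>} \<and> (\<forall>i. i \<notin> I \<longrightarrow> u i = \<zero>\<^bsub>R\<^esub>)},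
     monoid.mult = undefined, one = undefined, zero = (\<lambda>i. \<zero>\<^bsub>R\<^esub>),
     add = (\<lambda>u v i. u i \<oplus>\<^bsub>R\<^esub> v i), smult = (\<lambda>a u i. a \<otimes>\<^bsub>R\<^esub> u i)\<rparr>"

lemma free_module_simps:
  "\<zero>\<^bsub>free_module R I\<^esub> = (\<lambda>i. \<zero>\<^bsub>R\<^esub>)"
  "u \<oplus>\<^bsub>free_module R I\<^esub> v = (\<lambda>i. u i \<oplus>\<^bsub>R\<^esub> v i)"
  "a \<odot>\<^bsub>free_module R I\<^esub> u = (\<lambda>i. a \<otimes>\<^bsub>R\<^esub> u i)"
  by (simp_all add: free_module_def)

lemma left_module_free:
  fixes R :: "'r ring" and I :: "'i set"
  assumes "ring R"
  shows "left_module R (free_module R I)"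
proof -
  interpret ring R by fact
  have "finite {i. u i \<oplus>\<^bsub>R\<^esub> v i \<noteq> \<zero>\<^bsub>R\<^esub>}"
    if "finite {i. u i \<noteq> \<zero>\<^bsub>R\<^esub>}" "finite {i. v i \<noteq> \<zero>\<^bsub>R\<^esub>}" for u v :: "'i \<Rightarrow> 'r"
    by (rule finite_subset[of _ "{i. u i \<noteq> \<zero>\<^bsub>R\<^esub>} \<union> {i. v i \<noteq> \<zero>\<^bsub>R\<^esub>}"]) (use that in auto)
  moreover have "finite {i. a \<otimes>\<^bsub>R\<^esub> u i \<noteq> \<zero>\<^bsub>R\<^esub>}"
    if "finite {i. u i \<noteq> \<zero>\<^bsub>R\<^esub>}" "a \<in> carrier R" for u :: "'i \<Rightarrow> 'r" and a
    by (rule finite_subset[of _ "{i. u i \<noteq> \<zero>\<^bsub>R\<^esub>}"]) (use that in auto)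
  ultimately show ?thesis
    by (intro left_moduleI)
      (auto simp: assms free_module_def image_subset_iff a_assoc l_distr r_distr m_assoc fun_eq_iff
        intro: a_comm)
qed

lemma free_module_dual_basis:
  fixes R :: "'r ring" and I :: "'i set"
  assumes "ring R"
  shows "dual_basis R (free_module R I) I (\<lambda>i j. if j = i then \<one>\<^bsub>R\<^esub> else \<zero>\<^bsub>R\<^esub>) (\<lambda>i u. u i)"
proof -
  interpret ring R by fact
  interpret F: left_module R "free_module R I" by (rule left_module_free) fact
  let ?e = "\<lambda>i j. if j = i then \<one>\<^bsub>R\<^esub> else \<zero>\<^bsub>R\<^esub>"
  have e: "?e i \<in> carrier (free_module R I)" if "i \<in> I" for i
    using that by (auto simp: free_module_def)
  have coord: "(finsum (free_module R I) (\<lambda>i. c i \<odot>\<^bsub>free_module R I\<^esub> ?e i) A) j =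
      (if j \<in> A then c j else \<zero>\<^bsub>R\<^esub>)"
    if "finite A" "A \<subseteq> I" "c \<in> A \<rightarrow> carrier R" for A and c :: "'i \<Rightarrow> 'r" and j
    using that
  proof (induction A rule: finite_induct)
    case empty
    then show ?case by (simp only: F.finsum_empty) (simp add: free_module_simps)
  next
    case (insert a A)
    have "c i \<odot>\<^bsub>free_module R I\<^esub> ?e i \<in> carrier (free_module R I)" if "i \<in> insert a A" for i
      using that insert.prems by (intro F.smult_closed e) auto
    then have "finsum (free_module R I) (\<lambda>i. c i \<odot>\<^bsub>free_module R I\<^esub> ?e i) (insert a A) =
      (c a \<odot>\<^bsub>free_module R I\<^esub> ?e a) \<oplus>\<^bsub>free_module R I\<^esub>
      finsum (free_module R I) (\<lambda>i. c i \<odot>\<^bsub>free_module R I\<^esub> ?e i) A"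
      using insert by (intro F.finsum_insert) auto
    then show ?case
      using insert by (simp add: free_module_simps) (auto simp: Pi_iff)
  qed
  show ?thesis
    unfolding dual_basis_def
  proof (intro conjI ballI)
    fix i assume "i \<in> I"
    then show "?e i \<in> carrier (free_module R I)" by (rule e)
    show "(\<lambda>u. u i) \<in> lmod_hom R (free_module R I) (regular_module R)"
      by (rule lmod_homI) (auto simp: free_module_def)
  next
    fix u assume u: "u \<in> carrier (free_module R I)"
    then show fin: "finite {i \<in> I. u i \<noteq> \<zero>\<^bsub>R\<^esub>}"
      by (auto simp: free_module_def)
    have "u i \<in> carrier R" and "i \<notin> I \<Longrightarrow> u i = \<zero>\<^bsub>R\<^esub>" for i
      using u by (auto simp: free_module_def)
    then show "u = finsum (free_module R I) (\<lambda>i. u i \<odot>\<^bsub>free_module R I\<^esub> ?e i) {i \<in> I. u i \<noteq> \<zero>\<^bsub>R\<^esub>}"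
      using coord[OF fin, of u] by (auto simp: fun_eq_iff)
  qed
qed

text \<open>The other half of the dual basis lemma, with all elements of \<open>P\<close> as
  generators. Projectivity splits the canonical surjection from the free module on
  \<open>carrier P\<close>, and the coordinates of the splitting are the forms.\<close>

lemma projective_dual_basis:
  fixes R :: "'r ring" and P :: "('r, 'p) module"
  assumes "projective_lmod R P"
  obtains \<phi> where "dual_basis R P (carrier P) (\<lambda>b. b) \<phi>"
proof -
  interpret P: left_module R P using assms by (simp add: projective_lmod_def)
  let ?F = "free_module R (carrier P)"
  let ?e = "\<lambda>i j. if j = i then \<one>\<^bsub>R\<^esub> else \<zero>\<^bsub>R\<^esub>"
  interpret F: dual_basis_module R ?F "carrier P" ?e "\<lambda>i u. u i"
    by (intro dual_basis_moduleI left_module_free free_module_dual_basis P.R.ring_axioms)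
  define g where "g u = finsum P (\<lambda>i. u i \<odot>\<^bsub>P\<^esub> i) {i \<in> carrier P. u i \<noteq> \<zero>\<^bsub>R\<^esub>}" for u
  have g: "g \<in> lmod_hom R ?F P"
    unfolding g_def by (rule F.extension) (auto intro: P.left_module_axioms)
  have ge: "g (?e x) = x" if "x \<in> carrier P" for x
  proof (cases "\<one>\<^bsub>R\<^esub> = \<zero>\<^bsub>R\<^esub>")
    \<comment> \<open>Over the zero ring the unit vectors have empty support, but then
      \<open>P\<close> is zero as well.\<close>
    case True
    then have "x = \<zero>\<^bsub>P\<^esub>" using P.smult_one[OF that] P.smult_l_null[OF that] by simp
    moreover have "{i \<in> carrier P. ?e x i \<noteq> \<zero>\<^bsub>R\<^esub>} = {}" using True by auto
    ultimately show ?thesis unfolding g_def by (simp only: P.finsum_empty)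
  next
    case False
    then have "{i \<in> carrier P. ?e x i \<noteq> \<zero>\<^bsub>R\<^esub>} = {x}" using that by auto
    then show ?thesis using that by (simp add: g_def P.finsum_insert)
  qed
  have "g ` carrier ?F = carrier P"
  proof (intro equalityI subsetI)
    show "x \<in> g ` carrier ?F" if "x \<in> carrier P" for x
      using ge[OF that] F.q_closed[OF that] by (metis imageI)
  qed (use lmod_hom_closed[OF g] in auto)
  moreover have "(\<lambda>x. x) \<in> lmod_hom R P P" by (auto simp: lmod_hom_def)
  ultimately obtain h where h: "h \<in> lmod_hom R P ?F" and gh: "\<And>x. x \<in> carrier P \<Longrightarrow> g (h x) = x"
    using assms g P.left_module_axioms F.left_module_axioms
    unfolding projective_lmod_def by (metis (no_types, lifting))
  have "dual_basis R P (carrier P) (\<lambda>b. b) (\<lambda>b x. h x b)"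
    unfolding dual_basis_def
  proof (intro conjI ballI)
    show "(\<lambda>x. h x b) \<in> lmod_hom R P (regular_module R)" if "b \<in> carrier P" for b
      using lmod_hom_comp[OF h F.form_hom[OF that]] .
    fix x assume x: "x \<in> carrier P"
    then show "finite {i \<in> carrier P. h x i \<noteq> \<zero>\<^bsub>R\<^esub>}"
      using F.finite_support lmod_hom_closed[OF h] by auto
    show "x = (\<Oplus>\<^bsub>P\<^esub>i\<in>{i \<in> carrier P. h x i \<noteq> \<zero>\<^bsub>R\<^esub>}. h x i \<odot>\<^bsub>P\<^esub> i)"
      using gh[OF x] by (simp add: g_def)
  qed auto
  then show thesis by (rule that)
qed

section \<open>Coordinate quotients\<close>

context dual_basis_module
begin

text \<open>An element \<open>q i\<close> with \<open>i \<in> J\<close> need not belong to this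
  submodule, since its own support may leave \<open>J\<close>. It does so when \<open>J\<close> is
  closed.\<close>

definition supported :: "'i set \<Rightarrow> 'm set" where
  "supported J = {x \<in> carrier M. \<forall>i\<in>I. \<phi> i x \<noteq> \<zero> \<longrightarrow> i \<in> J}"

lemma submodule_supported: "submodule (supported J) R M"
proof (rule submoduleI)
  show "x \<oplus>\<^bsub>M\<^esub> y \<in> supported J" if "x \<in> supported J" "y \<in> supported J" for x y
    using that by (auto simp: supported_def form_add)
  show "a \<odot>\<^bsub>M\<^esub> x \<in> supported J" if "a \<in> carrier R" "x \<in> supported J" for a x
    using that R.r_null[of a] by (auto simp: supported_def form_smult)
qed (auto simp: supported_def)

lemma supported_subset:
  assumes "submodule H R M" and "\<And>i. i \<in> I \<Longrightarrow> i \<in> J \<Longrightarrow> q i \<in> H"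
  shows "supported J \<subseteq> H"
  using in_submodule_if_support[OF assms(1)] assms(2) by (auto simp: supported_def)

definition coordinates :: "'i set \<Rightarrow> 'm \<Rightarrow> nat \<Rightarrow> 'r" where
  "coordinates U x j =
     (if j \<in> to_nat_on U ` U then \<phi> (inv_into U (to_nat_on U) j) x else \<zero>)"

lemma coordinates_to_nat:
  "countable U \<Longrightarrow> b \<in> U \<Longrightarrow> coordinates U x (to_nat_on U b) = \<phi> b x"
  by (simp add: coordinates_def inv_into_f_f[OF inj_on_to_nat_on])

text \<open>A copy of \<open>supported K\<close> modulo \<open>supported (K - U)\<close>: the
  coordinates at \<open>U\<close> of an element supported in \<open>K\<close> vanish exactly if its
  support avoids \<open>U\<close>.\<close>

definition coordinate_module :: "'i set \<Rightarrow> 'i set \<Rightarrow> ('r, nat \<Rightarrow> 'r) module" where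
  "coordinate_module U K =
     \<lparr>carrier = coordinates U ` supported K, monoid.mult = undefined, one = undefined,
      zero = (\<lambda>j. \<zero>), add = (\<lambda>u v j. u j \<oplus> v j), smult = (\<lambda>a u j. a \<otimes> u j)\<rparr>"

context
  fixes U K :: "'i set"
  assumes U: "countable U" "U \<subseteq> I" "U \<subseteq> K"
begin

lemma
  shows left_module_coordinate: "left_module R (coordinate_module U K)"
    and coordinates_hom:
      "coordinates U \<in> lmod_hom R (M\<lparr>carrier := supported K\<rparr>) (coordinate_module U K)"
proof -
  have inv: "inv_into U (to_nat_on U) j \<in> I" if "j \<in> to_nat_on U ` U" for j
    using inv_into_into[OF that] U(2) by auto
  have L: "left_module R (M\<lparr>carrier := supported K\<rparr>)"
    by (rule left_module_restrict[OF left_module_axioms submodule_supported])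
  note * = left_module_image[OF L, of "coordinates U" "coordinate_module U K"]
  show "left_module R (coordinate_module U K)"
    by (rule *(1)) (auto simp: coordinate_module_def coordinates_def inv form_add form_smult fun_eq_iff
      supported_def)
  show "coordinates U \<in> lmod_hom R (M\<lparr>carrier := supported K\<rparr>) (coordinate_module U K)"
    by (rule *(2)) (auto simp: coordinate_module_def coordinates_def inv form_add form_smult fun_eq_iff
      supported_def)
qed

lemma coordinates_eq_zero_iff:
  assumes "x \<in> supported K"
  shows "coordinates U x = \<zero>\<^bsub>coordinate_module U K\<^esub> \<longleftrightarrow> x \<in> supported (K - U)"
proof
  assume "coordinates U x = \<zero>\<^bsub>coordinate_module U K\<^esub>"
  then have "\<phi> b x = \<zero>" if "b \<in> U" for b
    using coordinates_to_nat[OF U(1) that, of x] by (simp add: coordinate_module_def)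
  then show "x \<in> supported (K - U)"
    using assms by (auto simp: supported_def)
next
  assume x: "x \<in> supported (K - U)"
  have "\<phi> (inv_into U (to_nat_on U) j) x = \<zero>" if "j \<in> to_nat_on U ` U" for j
    using inv_into_into[OF that] U(2) x by (auto simp: supported_def)
  then show "coordinates U x = \<zero>\<^bsub>coordinate_module U K\<^esub>"
    by (auto simp: coordinate_module_def coordinates_def fun_eq_iff)
qed

text \<open>Apply \<open>coordinates U\<close> to the expansion of an element of
  \<open>supported K\<close>. The generators with index in \<open>K - U\<close> lie in the kernel by
  \<open>KU\<close>, so only terms with index in \<open>U\<close> survive, and their coefficients
  are entries of the image.\<close>

lemma coordinate_dual_basis:
  assumes K: "\<And>b. b \<in> I \<Longrightarrow> b \<in> K \<Longrightarrow> q b \<in> supported K"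
    and KU: "\<And>b. b \<in> I \<Longrightarrow> b \<in> K - U \<Longrightarrow> q b \<in> supported (K - U)"
  shows "dual_basis R (coordinate_module U K) U (\<lambda>b. coordinates U (q b)) (\<lambda>b u. u (to_nat_on U b))"
  unfolding dual_basis_def
proof (intro conjI ballI)
  let ?N = "coordinate_module U K"
  interpret N: left_module R ?N by (rule left_module_coordinate)
  interpret \<kappa>: lmod_hom_pair R "M\<lparr>carrier := supported K\<rparr>" ?N "coordinates U"
    by (intro lmod_hom_pairI left_module_coordinate coordinates_hom
      left_module_restrict[OF left_module_axioms submodule_supported])
  {
    fix b assume b: "b \<in> U"
    show qb: "coordinates U (q b) \<in> carrier ?N"
      using K[of b] U b by (auto simp: coordinate_module_def)
    show "(\<lambda>u. u (to_nat_on U b)) \<in> lmod_hom R ?N (regular_module R)"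
      using b U
      by (intro lmod_homI)
        (auto simp: coordinate_module_def coordinates_to_nat supported_def)
  }
  fix u assume "u \<in> carrier ?N"
  then obtain x where x: "x \<in> supported K" and u: "u = coordinates U x"
    by (auto simp: coordinate_module_def)
  then have xM: "x \<in> carrier M" by (simp add: supported_def)
  have eq: "{b \<in> U. u (to_nat_on U b) \<noteq> \<zero>} = {b \<in> I. \<phi> b x \<noteq> \<zero>} \<inter> U"
    using U by (auto simp: u coordinates_to_nat)
  show "finite {b \<in> U. u (to_nat_on U b) \<noteq> \<zero>}"
    unfolding eq using xM by auto
  let ?S = "{b \<in> I. \<phi> b x \<noteq> \<zero>}"
  have SK: "?S \<subseteq> K" using x by (auto simp: supported_def)
  have mem: "\<phi> b x \<odot>\<^bsub>M\<^esub> q b \<in> supported K" if "b \<in> ?S" for b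
    using that SK K xM submodule_smult[OF submodule_supported] by auto
  have "x = finsum M (\<lambda>b. \<phi> b x \<odot>\<^bsub>M\<^esub> q b) ?S"
    using expansion[OF xM] by simp
  \<comment> \<open>The sum is moved into the submodule, because \<open>coordinates U\<close> is a
    homomorphism only there.\<close>
  also have "\<dots> = finsum (M\<lparr>carrier := supported K\<rparr>) (\<lambda>b. \<phi> b x \<odot>\<^bsub>M\<^esub> q b) ?S"
  proof -
    interpret S: lmod_hom_pair R "M\<lparr>carrier := supported K\<rparr>" M "\<lambda>x. x"
      by (intro lmod_hom_pairI left_module_axioms \<kappa>.M.left_module_axioms)
        (auto simp: lmod_hom_def supported_def)
    show ?thesis
      using S.finsum[of "\<lambda>b. \<phi> b x \<odot>\<^bsub>M\<^esub> q b" ?S] mem by auto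
  qed
  finally have "u = finsum ?N (\<lambda>b. coordinates U (\<phi> b x \<odot>\<^bsub>M\<^esub> q b)) ?S"
    using u \<kappa>.finsum[of "\<lambda>b. \<phi> b x \<odot>\<^bsub>M\<^esub> q b" ?S] mem by auto
  also have "\<dots> = finsum ?N (\<lambda>b. \<phi> b x \<odot>\<^bsub>?N\<^esub> coordinates U (q b)) ?S"
  proof (rule N.finsum_cong')
    have "coordinates U (q b) \<in> carrier ?N" if "b \<in> ?S" for b
      using that SK K by (auto simp: coordinate_module_def)
    then show "(\<lambda>b. \<phi> b x \<odot>\<^bsub>?N\<^esub> coordinates U (q b)) \<in> ?S \<rightarrow> carrier ?N"
      using xM by auto
    show "coordinates U (\<phi> b x \<odot>\<^bsub>M\<^esub> q b) = \<phi> b x \<odot>\<^bsub>?N\<^esub> coordinates U (q b)" if "b \<in> ?S" for b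
      using that SK K xM \<kappa>.smult[of "\<phi> b x" "q b"] by auto
  qed simp
  also have "\<dots> = finsum ?N (\<lambda>b. u (to_nat_on U b) \<odot>\<^bsub>?N\<^esub> coordinates U (q b))
      {b \<in> U. u (to_nat_on U b) \<noteq> \<zero>}"
    unfolding eq
  proof (rule N.add.finprod_mono_neutral_cong_right)
    show "finite ?S" using xM by simp
    have cl: "coordinates U (q b) \<in> carrier ?N" if "b \<in> ?S" for b
      using that SK K by (auto simp: coordinate_module_def)
    then show "(\<lambda>b. \<phi> b x \<odot>\<^bsub>?N\<^esub> coordinates U (q b)) \<in> ?S \<rightarrow> carrier ?N"
      using xM by auto
    fix b assume b: "b \<in> ?S - ?S \<inter> U"
    then have "coordinates U (q b) = \<zero>\<^bsub>?N\<^esub>"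
      using coordinates_eq_zero_iff[of "q b"] KU[of b] K[of b] SK by auto
    then show "\<phi> b x \<odot>\<^bsub>?N\<^esub> coordinates U (q b) = \<zero>\<^bsub>?N\<^esub>"
      using b xM by simp
  qed (use U in \<open>auto simp: u coordinates_to_nat\<close>)
  finally show "u = finsum ?N (\<lambda>b. u (to_nat_on U b) \<odot>\<^bsub>?N\<^esub> coordinates U (q b))
      {b \<in> U. u (to_nat_on U b) \<noteq> \<zero>}" .
qed

end

end

section \<open>Quotients of resolutions\<close>

text \<open>The value of \<open>G\<close> is \<open>F\<close> at a chosen preimage. Two preimages
  differ by an element of the kernel of \<open>\<kappa>\<close>, on which \<open>F\<close> vanishes,
  so the choice does not matter.\<close>

lemma lmod_hom_factor:
  assumes "left_module R B" "left_module R N" "left_module R L"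
    and \<kappa>: "\<kappa> \<in> lmod_hom R B N" "\<kappa> ` carrier B = carrier N"
    and F: "F \<in> lmod_hom R B L"
    and ker: "\<And>x. x \<in> carrier B \<Longrightarrow> \<kappa> x = \<zero>\<^bsub>N\<^esub> \<Longrightarrow> F x = \<zero>\<^bsub>L\<^esub>"
  obtains G where "G \<in> lmod_hom R N L" "\<And>x. x \<in> carrier B \<Longrightarrow> G (\<kappa> x) = F x"
proof
  interpret k: lmod_hom_pair R B N \<kappa> using assms by (intro lmod_hom_pairI)
  interpret F: lmod_hom_pair R B L F using assms by (intro lmod_hom_pairI)
  let ?G = "\<lambda>u. F (SOME x. x \<in> carrier B \<and> \<kappa> x = u)"
  show G: "?G (\<kappa> x) = F x" if x: "x \<in> carrier B" for x
  proof -
    define y where "y = (SOME y. y \<in> carrier B \<and> \<kappa> y = \<kappa> x)"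
    have y: "y \<in> carrier B \<and> \<kappa> y = \<kappa> x"
      unfolding y_def by (rule someI[of _ x]) (use x in simp)
    then have "\<kappa> (y \<ominus>\<^bsub>B\<^esub> x) = \<zero>\<^bsub>N\<^esub>" using x by (simp add: k.minus k.N.diff_self)
    then have "F y \<ominus>\<^bsub>L\<^esub> F x = \<zero>\<^bsub>L\<^esub>" using ker[of "y \<ominus>\<^bsub>B\<^esub> x"] x y F.minus[of y x] by simp
    then have "F y = F x" using x y F.N.eq_if_diff_zero[of "F y" "F x"] by simp
    then show ?thesis unfolding y_def .
  qed
  show "?G \<in> lmod_hom R N L"
  proof (rule lmod_homI)
    fix u assume "u \<in> carrier N"
    then obtain x where "x \<in> carrier B" "u = \<kappa> x" using \<kappa>(2) by auto
    then show "?G u \<in> carrier L" using G by simp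
  next
    fix u v assume "u \<in> carrier N" "v \<in> carrier N"
    then obtain x y where xy: "x \<in> carrier B" "u = \<kappa> x" "y \<in> carrier B" "v = \<kappa> y"
      using \<kappa>(2) by (metis imageE)
    then have "?G (u \<oplus>\<^bsub>N\<^esub> v) = ?G (\<kappa> (x \<oplus>\<^bsub>B\<^esub> y))" by (simp add: k.add)
    also have "\<dots> = ?G u \<oplus>\<^bsub>L\<^esub> ?G v" using G xy by (simp only: k.M.a_closed F.add)
    finally show "?G (u \<oplus>\<^bsub>N\<^esub> v) = ?G u \<oplus>\<^bsub>L\<^esub> ?G v" .
  next
    fix a u assume a: "a \<in> carrier R" and "u \<in> carrier N"
    then obtain x where x: "x \<in> carrier B" "u = \<kappa> x" using \<kappa>(2) by auto
    then have "?G (a \<odot>\<^bsub>N\<^esub> u) = ?G (\<kappa> (a \<odot>\<^bsub>B\<^esub> x))" using a by (simp add: k.smult)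
    also have "\<dots> = a \<odot>\<^bsub>L\<^esub> ?G u" using G x a by (simp only: k.M.smult_closed F.smult)
    finally show "?G (a \<odot>\<^bsub>N\<^esub> u) = a \<odot>\<^bsub>L\<^esub> ?G u" .
  qed
qed


text \<open>The families \<open>A\<close> and \<open>B\<close> are exact subcomplexes of the
  resolution, and \<open>\<kappa>\<close> presents \<open>N\<close> as a copy of \<open>B\<close>
  modulo \<open>A\<close>. Diagram chase: if the class of \<open>x\<close> is a cycle, exactness of
  \<open>A\<close> yields \<open>y\<close> in \<open>A\<close> with the same image as
  \<open>x\<close>; then \<open>x - y\<close> is a cycle of \<open>P\<close>, hence a boundary from
  \<open>B\<close>, and the class of \<open>x\<close> is that boundary. In degree 0 the element
  \<open>y\<close> comes from \<open>g_ker\<close> instead.\<close>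

lemma exact_resolution_quotient:
  fixes R :: "'r ring" and P :: "nat \<Rightarrow> ('r, 'p) module" and N :: "nat \<Rightarrow> ('r, 'q) module"
    and X :: "('r, 'm) module" and C :: "('r, 'c) module"
  assumes res: "exact_resolution R n P d \<epsilon> X"
    and A: "\<And>k. submodule (A k) R (P k)" and B: "\<And>k. submodule (B k) R (P k)"
    and AB: "\<And>k. A k \<subseteq> B k"
    and dA: "\<And>k. d k ` A (Suc k) \<subseteq> A k" and dB: "\<And>k. d k ` B (Suc k) \<subseteq> B k"
    and exA: "\<And>k. A k \<inter> d k ` carrier (P (Suc k)) \<subseteq> d k ` A (Suc k)"
    and exB: "\<And>k. B k \<inter> d k ` carrier (P (Suc k)) \<subseteq> d k ` B (Suc k)"
    and N: "\<And>k. left_module R (N k)"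
    and \<kappa>: "\<And>k. \<kappa> k \<in> lmod_hom R ((P k)\<lparr>carrier := B k\<rparr>) (N k)"
    and \<kappa>_surj: "\<And>k. \<kappa> k ` B k = carrier (N k)"
    and \<kappa>_ker: "\<And>k x. x \<in> B k \<Longrightarrow> \<kappa> k x = \<zero>\<^bsub>N k\<^esub> \<longleftrightarrow> x \<in> A k"
    and C: "left_module R C"
    and g: "g \<in> lmod_hom R (X\<lparr>carrier := \<epsilon> ` B 0\<rparr>) C"
    and g_surj: "g ` \<epsilon> ` B 0 = carrier C"
    and g_ker: "\<And>y. y \<in> \<epsilon> ` B 0 \<Longrightarrow> g y = \<zero>\<^bsub>C\<^esub> \<longleftrightarrow> y \<in> \<epsilon> ` A 0"
  shows "\<exists>d' \<epsilon>'. exact_resolution R n N d' \<epsilon>' C"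
proof -
  have X: "left_module R X" and P: "\<And>k. left_module R (P k)"
    and Pz: "\<And>k. n < k \<Longrightarrow> carrier (P k) = {\<zero>\<^bsub>P k\<^esub>}"
    and \<epsilon>: "\<epsilon> \<in> lmod_hom R (P 0) X" and d: "\<And>k. d k \<in> lmod_hom R (P (Suc k)) (P k)"
    and ker\<epsilon>: "lmod_ker (P 0) X \<epsilon> = d 0 ` carrier (P 1)"
    and kerd: "\<And>k. lmod_ker (P (Suc k)) (P k) (d k) = d (Suc k) ` carrier (P (Suc (Suc k)))"
    using res by (auto simp: exact_resolution_def)
  have \<epsilon>B: "submodule (\<epsilon> ` B 0) R X"
    by (intro lmod_hom_pair.submodule_image[OF lmod_hom_pairI[OF P X \<epsilon>]] B)
  let ?B = "\<lambda>k. (P k)\<lparr>carrier := B k\<rparr>" and ?Y = "X\<lparr>carrier := \<epsilon> ` B 0\<rparr>"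
  have Bm: "left_module R (?B k)" for k by (intro left_module_restrict P B)
  have Bc: "x \<in> carrier (P k)" if "x \<in> B k" for x k using submodule_carrier[OF B that] .
  have dBm: "d k \<in> lmod_hom R (?B (Suc k)) (?B k)" for k
    using lmod_hom_restrict[OF d, of "B (Suc k)" k "B k"] dB[of k] Bc by blast
  have \<epsilon>Bm: "\<epsilon> \<in> lmod_hom R (?B 0) ?Y"
    using lmod_hom_restrict[OF \<epsilon>, of "B 0" "\<epsilon> ` B 0"] Bc by blast
  have dB': "d k x \<in> B k" if "x \<in> B (Suc k)" for k x using dB[of k] that by auto
  have "\<exists>G. G \<in> lmod_hom R (N (Suc k)) (N k) \<and> (\<forall>x\<in>B (Suc k). G (\<kappa> (Suc k) x) = \<kappa> k (d k x))" for k
  proof (rule lmod_hom_factor[OF Bm N N \<kappa>[of "Suc k"], of "\<lambda>x. \<kappa> k (d k x)" k])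
    show "(\<lambda>x. \<kappa> k (d k x)) \<in> lmod_hom R (?B (Suc k)) (N k)"
      by (rule lmod_hom_comp[OF dBm \<kappa>])
    fix x assume "x \<in> carrier (?B (Suc k))" "\<kappa> (Suc k) x = \<zero>\<^bsub>N (Suc k)\<^esub>"
    then show "\<kappa> k (d k x) = \<zero>\<^bsub>N k\<^esub>" using \<kappa>_ker[of x "Suc k"] \<kappa>_ker[of "d k x" k] dA[of k] dB'[of x k] by auto
  qed (use \<kappa>_surj in auto)
  then obtain d' where d': "\<And>k. d' k \<in> lmod_hom R (N (Suc k)) (N k)"
    and d'\<kappa>: "\<And>k x. x \<in> B (Suc k) \<Longrightarrow> d' k (\<kappa> (Suc k) x) = \<kappa> k (d k x)"
    by metis
  obtain \<epsilon>' where \<epsilon>': "\<epsilon>' \<in> lmod_hom R (N 0) C" and \<epsilon>'\<kappa>: "\<And>x. x \<in> B 0 \<Longrightarrow> \<epsilon>' (\<kappa> 0 x) = g (\<epsilon> x)"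
  proof (rule lmod_hom_factor[OF Bm N C \<kappa>[of 0], of "\<lambda>x. g (\<epsilon> x)"])
    show "(\<lambda>x. g (\<epsilon> x)) \<in> lmod_hom R (?B 0) C"
      by (rule lmod_hom_comp[OF \<epsilon>Bm g])
    fix x assume "x \<in> carrier (?B 0)" "\<kappa> 0 x = \<zero>\<^bsub>N 0\<^esub>"
    then show "g (\<epsilon> x) = \<zero>\<^bsub>C\<^esub>" using \<kappa>_ker[of x 0] g_ker[of "\<epsilon> x"] by auto
  qed (use \<kappa>_surj in auto)
  \<comment> \<open>The last part of the chase, shared by all degrees: an element that is a boundary
    modulo \<open>A\<close> has a boundary as its class.\<close>
  have exact: "\<exists>w\<in>B (Suc k). \<kappa> k x = d' k (\<kappa> (Suc k) w)"
    if x: "x \<in> B k" and y: "y \<in> A k" and xy: "x \<ominus>\<^bsub>P k\<^esub> y \<in> d k ` carrier (P (Suc k))" for k x y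
  proof -
    interpret P: left_module R "P k" by (rule P)
    interpret K: lmod_hom_pair R "?B k" "N k" "\<kappa> k" by (intro lmod_hom_pairI Bm N \<kappa>)
    have yB: "y \<in> B k" using y AB by auto
    have "x \<ominus>\<^bsub>P k\<^esub> y \<in> B k" using P.submodule_minus[OF B x yB] .
    then obtain w where w: "w \<in> B (Suc k)" "x \<ominus>\<^bsub>P k\<^esub> y = d k w" using exB[of k] xy by auto
    have "x = d k w \<oplus>\<^bsub>P k\<^esub> y"
      using Bc[OF x] Bc[OF yB] unfolding w(2)[symmetric] by (simp add: a_minus_def P.M.a_assoc P.M.l_neg)
    then have "\<kappa> k x = \<kappa> k (d k w) \<oplus>\<^bsub>N k\<^esub> \<kappa> k y"
      using K.add[of "d k w" y] dB'[OF w(1)] yB by simp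
    then have "\<kappa> k x = \<kappa> k (d k w)"
      using \<kappa>_ker[OF yB] y K.closed[of "d k w"] dB'[OF w(1)] by simp
    then show ?thesis using w(1) d'\<kappa> by metis
  qed
  have 1: "carrier (N k) = {\<zero>\<^bsub>N k\<^esub>}" if k: "n < k" for k
  proof -
    have z: "\<zero>\<^bsub>P k\<^esub> \<in> A k" "\<zero>\<^bsub>P k\<^esub> \<in> B k" using submodule_zero[OF A] submodule_zero[OF B] .
    have "B k = {\<zero>\<^bsub>P k\<^esub>}" using z(2) Bc[of _ k] unfolding Pz[OF k] by blast
    then show ?thesis using \<kappa>_surj[of k] \<kappa>_ker[OF z(2)] z(1) by auto
  qed
  have 2: "\<epsilon>' ` carrier (N 0) = carrier C"
  proof (intro equalityI subsetI)
    fix u assume "u \<in> \<epsilon>' ` carrier (N 0)"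
    then show "u \<in> carrier C" using lmod_hom_closed[OF \<epsilon>'] by auto
  next
    fix u assume "u \<in> carrier C"
    then obtain x where "x \<in> B 0" "u = g (\<epsilon> x)" using g_surj by auto
    then show "u \<in> \<epsilon>' ` carrier (N 0)" using \<epsilon>'\<kappa> \<kappa>_surj[of 0] by (metis imageI)
  qed
  have 3: "lmod_ker (N 0) C \<epsilon>' = d' 0 ` carrier (N 1)"
  proof (intro equalityI subsetI)
    fix u assume "u \<in> lmod_ker (N 0) C \<epsilon>'"
    then obtain x where x: "x \<in> B 0" "u = \<kappa> 0 x" "\<epsilon>' u = \<zero>\<^bsub>C\<^esub>"
      by (auto simp: lmod_ker_def \<kappa>_surj[symmetric])
    then obtain y where y: "y \<in> A 0" "\<epsilon> x = \<epsilon> y"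
      using g_ker[of "\<epsilon> x"] \<epsilon>'\<kappa>[of x] by auto
    interpret \<epsilon>: lmod_hom_pair R "P 0" X \<epsilon> by (intro lmod_hom_pairI P X \<epsilon>)
    have "x \<ominus>\<^bsub>P 0\<^esub> y \<in> lmod_ker (P 0) X \<epsilon>"
      using Bc[OF x(1)] submodule_carrier[OF A y(1)] y(2) by (simp add: lmod_ker_def \<epsilon>.minus \<epsilon>.N.diff_self)
    then have "x \<ominus>\<^bsub>P 0\<^esub> y \<in> d 0 ` carrier (P (Suc 0))" using ker\<epsilon> by simp
    from exact[OF x(1) y(1) this] show "u \<in> d' 0 ` carrier (N 1)"
      using x(2) by (auto simp: \<kappa>_surj[symmetric])
  next
    fix u assume "u \<in> d' 0 ` carrier (N 1)"
    then obtain w where w: "w \<in> B (Suc 0)" "u = d' 0 (\<kappa> (Suc 0) w)"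
      by (auto simp: \<kappa>_surj[symmetric])
    have "d 0 w \<in> lmod_ker (P 0) X \<epsilon>" using Bc[OF w(1)] ker\<epsilon> by auto
    moreover have "\<zero>\<^bsub>X\<^esub> \<in> \<epsilon> ` A 0"
      using submodule_zero[OF A] lmod_hom_pair.zero[OF lmod_hom_pairI[OF P X \<epsilon>]] by (metis imageI)
    ultimately have "\<epsilon> (d 0 w) \<in> \<epsilon> ` A 0" by (simp add: lmod_ker_def)
    then have "g (\<epsilon> (d 0 w)) = \<zero>\<^bsub>C\<^esub>" using g_ker[OF imageI[OF dB'[OF w(1)]]] by simp
    then have "\<epsilon>' u = \<zero>\<^bsub>C\<^esub>"
      using w(2) d'\<kappa>[OF w(1)] \<epsilon>'\<kappa>[OF dB'[OF w(1)]] by simp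
    then show "u \<in> lmod_ker (N 0) C \<epsilon>'"
      using w d'\<kappa>[OF w(1)] dB'[OF w(1)] \<kappa>_surj[of 0] by (auto simp: lmod_ker_def)
  qed
  have 4: "lmod_ker (N (Suc k)) (N k) (d' k) = d' (Suc k) ` carrier (N (Suc (Suc k)))" for k
  proof (intro equalityI subsetI)
    fix u assume "u \<in> lmod_ker (N (Suc k)) (N k) (d' k)"
    then obtain x where x: "x \<in> B (Suc k)" "u = \<kappa> (Suc k) x" "d' k u = \<zero>\<^bsub>N k\<^esub>"
      by (auto simp: lmod_ker_def \<kappa>_surj[symmetric])
    then have "d k x \<in> A k"
      using \<kappa>_ker[of "d k x" k] d'\<kappa>[of x k] dB' by auto
    moreover have "d k x \<in> d k ` carrier (P (Suc k))" using Bc x(1) by blast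
    ultimately obtain y where y: "y \<in> A (Suc k)" "d k x = d k y"
      using exA[of k] by auto
    interpret d: lmod_hom_pair R "P (Suc k)" "P k" "d k" by (intro lmod_hom_pairI P d)
    have "x \<ominus>\<^bsub>P (Suc k)\<^esub> y \<in> lmod_ker (P (Suc k)) (P k) (d k)"
      using Bc[OF x(1)] submodule_carrier[OF A y(1)] y(2) by (simp add: lmod_ker_def d.minus d.N.diff_self)
    from exact[OF x(1) y(1) this[unfolded kerd]]
    show "u \<in> d' (Suc k) ` carrier (N (Suc (Suc k)))"
      using x(2) by (auto simp: \<kappa>_surj[symmetric])
  next
    fix u assume "u \<in> d' (Suc k) ` carrier (N (Suc (Suc k)))"
    then obtain w where w: "w \<in> B (Suc (Suc k))" "u = d' (Suc k) (\<kappa> (Suc (Suc k)) w)"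
      by (auto simp: \<kappa>_surj[symmetric])
    have "d (Suc k) w \<in> lmod_ker (P (Suc k)) (P k) (d k)" using Bc[OF w(1)] kerd by auto
    moreover have "\<kappa> k \<zero>\<^bsub>P k\<^esub> = \<zero>\<^bsub>N k\<^esub>"
      using \<kappa>_ker[of "\<zero>\<^bsub>P k\<^esub>" k] submodule_zero[OF A] submodule_zero[OF B] by auto
    ultimately have "d' k u = \<zero>\<^bsub>N k\<^esub>"
      using w d'\<kappa> dB'[OF w(1)] by (auto simp: lmod_ker_def)
    then show "u \<in> lmod_ker (N (Suc k)) (N k) (d' k)"
      using w d'\<kappa>[OF w(1)] dB'[OF w(1)] \<kappa>_surj[of "Suc k"] by (auto simp: lmod_ker_def)
  qed
  have "exact_resolution R n N d' \<epsilon>' C"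
    unfolding exact_resolution_def by (intro conjI allI impI C N \<epsilon>' d' 1 2 3 4)
  then show ?thesis by blast
qed

section \<open>Countable generation over a left Noetherian ring\<close>

lemma left_ideal_if_submodule:
  assumes "submodule J R (regular_module R)"
  shows "left_ideal J R"
  using submodule.axioms[OF assms] submodule.smult_closed[OF assms]
  by (simp add: left_ideal_def additive_subgroup_def regular_module_def subgroup_def m_inv_def)

text \<open>The generators are lifts of generators of the left ideals of leading coefficients, as in the
  proof of Hilbert's basis theorem.\<close>

lemma noetherian_countable_generation:
  fixes R :: "'r ring" and M :: "('r, 'm) module"
  assumes noeth: "left_noetherian R" and M: "left_module R M" and K: "submodule K R M"
    and U: "countable U"
    and \<phi>: "\<And>b. b \<in> U \<Longrightarrow> \<phi> b \<in> lmod_hom R M (regular_module R)"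
    and fin: "\<And>x. x \<in> K \<Longrightarrow> finite {b \<in> U. \<phi> b x \<noteq> \<zero>\<^bsub>R\<^esub>}"
  obtains A where "countable A" "A \<subseteq> K"
    "\<And>x H. x \<in> K \<Longrightarrow> submodule H R M \<Longrightarrow> A \<subseteq> H \<Longrightarrow> \<exists>a\<in>H \<inter> K. \<forall>b\<in>U. \<phi> b (x \<ominus>\<^bsub>M\<^esub> a) = \<zero>\<^bsub>R\<^esub>"
proof -
  interpret M: left_module R M by fact
  interpret RR: left_module R "regular_module R" by (rule left_module_regular) (rule M.R.ring_axioms)
  \<comment> \<open>The forms are enumerated by natural numbers, with the zero form at the positions
    that are not taken; the position plays the role of the degree in Hilbert's theorem.\<close>
  define c where "c j = (if j \<in> to_nat_on U ` U then \<phi> (inv_into U (to_nat_on U) j) else (\<lambda>x. \<zero>\<^bsub>R\<^esub>))" for j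
  have c: "lmod_hom_pair R M (regular_module R) (c j)" for j
    using \<phi>[OF inv_into_into[of j "to_nat_on U" U]]
    by (intro lmod_hom_pairI M RR.left_module_axioms) (auto simp: c_def lmod_hom_def)
  have c_\<phi>: "c (to_nat_on U b) = \<phi> b" if "b \<in> U" for b
    using inv_into_f_f[OF inj_on_to_nat_on[OF U] that] that by (simp add: c_def)
  have c_fin: "\<exists>m. \<forall>j\<ge>m. c j x = \<zero>\<^bsub>R\<^esub>" if "x \<in> K" for x
  proof -
    have "{j. c j x \<noteq> \<zero>\<^bsub>R\<^esub>} \<subseteq> to_nat_on U ` {b \<in> U. \<phi> b x \<noteq> \<zero>\<^bsub>R\<^esub>}"
    proof
      fix j assume j: "j \<in> {j. c j x \<noteq> \<zero>\<^bsub>R\<^esub>}"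
      then obtain b where "b \<in> U" "j = to_nat_on U b" by (auto simp: c_def split: if_splits)
      then show "j \<in> to_nat_on U ` {b \<in> U. \<phi> b x \<noteq> \<zero>\<^bsub>R\<^esub>}" using j c_\<phi> by auto
    qed
    then have "finite {j. c j x \<noteq> \<zero>\<^bsub>R\<^esub>}" using fin[OF that] by (meson finite_imageI finite_subset)
    then obtain m where "\<forall>j\<in>{j. c j x \<noteq> \<zero>\<^bsub>R\<^esub>}. j < m" using finite_nat_set_iff_bounded by auto
    then show ?thesis by (intro exI[of _ m]) force
  qed
  \<comment> \<open>The elements of degree below \<open>m\<close>. They exhaust \<open>K\<close>,
    since each element of \<open>K\<close> has only finitely many nonzero coordinates.\<close>
  define F where "F m = {x \<in> K. \<forall>j\<ge>m. c j x = \<zero>\<^bsub>R\<^esub>}" for m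
  have F: "submodule (F m) R M" for m
    using submodule_zero[OF K] submodule_add[OF K] submodule_smult[OF K] submodule_carrier[OF K]
    by (intro M.submoduleI)
      (auto simp: F_def lmod_hom_pair.add[OF c] lmod_hom_pair.smult[OF c] lmod_hom_pair.zero[OF c])
  \<comment> \<open>The coefficients at position \<open>m\<close> of the elements of
    \<open>F (Suc m)\<close> form a left ideal with finitely many generators, and \<open>A\<close>
    consists of lifts of these. A submodule \<open>H\<close> containing \<open>A\<close> therefore
    realises every such coefficient by an element of \<open>H \<inter> F (Suc m)\<close>.\<close>
  have "\<exists>A. finite A \<and> A \<subseteq> F (Suc m) \<and>
    (\<forall>x\<in>F (Suc m). \<forall>H. submodule H R M \<longrightarrow> A \<subseteq> H \<longrightarrow> (\<exists>a\<in>H \<inter> F (Suc m). c m a = c m x))" for m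
  proof -
    interpret cm: lmod_hom_pair R M "regular_module R" "c m" by (rule c)
    have "left_ideal (c m ` F (Suc m)) R"
      by (intro left_ideal_if_submodule cm.submodule_image F)
    then obtain A' where A': "finite A'" "c m ` F (Suc m) = (\<lambda>I. left_ideal I R) hull A'"
      using noeth by (auto simp: left_noetherian_def)
    then have "A' \<subseteq> c m ` F (Suc m)" by (simp add: hull_subset)
    then obtain A where A: "A \<subseteq> F (Suc m)" "finite A" "A' = c m ` A"
      using A'(1) by (meson finite_subset_image)
    have "\<exists>a\<in>H \<inter> F (Suc m). c m a = c m x"
      if x: "x \<in> F (Suc m)" and H: "submodule H R M" "A \<subseteq> H" for x H
    proof -
      have "left_ideal (c m ` (H \<inter> F (Suc m))) R"
        by (intro left_ideal_if_submodule cm.submodule_image submodule_Int M H F)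
      then have "(\<lambda>I. left_ideal I R) hull A' \<subseteq> c m ` (H \<inter> F (Suc m))"
        using A H(2) by (intro hull_minimal) auto
      then have "c m x \<in> c m ` (H \<inter> F (Suc m))" using A'(2) x by auto
      then show ?thesis by auto
    qed
    then show ?thesis using A by blast
  qed
  then obtain A where A: "\<And>m. finite (A m)" "\<And>m. A m \<subseteq> F (Suc m)"
    and lift: "\<And>m x H. x \<in> F (Suc m) \<Longrightarrow> submodule H R M \<Longrightarrow> A m \<subseteq> H \<Longrightarrow>
      \<exists>a\<in>H \<inter> F (Suc m). c m a = c m x"
    by metis
  show thesis
  proof
    show "countable (\<Union>m. A m)" using A(1) by (simp add: countable_finite)
    show "(\<Union>m. A m) \<subseteq> K" using A(2) by (force simp: F_def)
    fix x H assume x: "x \<in> K" and H: "submodule H R M" "(\<Union>m. A m) \<subseteq> H"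
    \<comment> \<open>Induction on the degree: subtracting an element of \<open>H\<close> with the
      same coefficient at position \<open>m\<close> leads from \<open>F (Suc m)\<close> to
      \<open>F m\<close>. The subtracted elements add up to \<open>a\<close>.\<close>
    have "\<exists>a\<in>H \<inter> K. \<forall>j. c j (y \<ominus>\<^bsub>M\<^esub> a) = \<zero>\<^bsub>R\<^esub>" if "y \<in> F m" for m y
      using that
    proof (induction m arbitrary: y)
      case 0
      have "y \<in> K" "\<forall>j. c j y = \<zero>\<^bsub>R\<^esub>" using 0 by (auto simp: F_def)
      then show ?case
        using submodule_zero[OF K] submodule_zero[OF H(1)] submodule_carrier[OF K]
        by (intro bexI[of _ "\<zero>\<^bsub>M\<^esub>"]) (auto simp: M.diff_zero)
    next
      case (Suc m)
      have "A m \<subseteq> H" using H(2) by auto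
      then obtain a where a: "a \<in> H" "a \<in> F (Suc m)" "c m a = c m y"
        using lift[OF Suc.prems H(1)] by auto
      have K': "F m \<subseteq> K" for m by (auto simp: F_def)
      have aM: "a \<in> carrier M" and yM: "y \<in> carrier M"
        using a Suc.prems K' submodule_carrier[OF K] by blast+
      have "y \<ominus>\<^bsub>M\<^esub> a \<in> F (Suc m)" using M.submodule_minus[OF F Suc.prems a(2)] .
      moreover have "c m (y \<ominus>\<^bsub>M\<^esub> a) = \<zero>\<^bsub>R\<^esub>"
        using lmod_hom_pair.minus[OF c yM aM, of m] a(3) lmod_hom_pair.closed[OF c yM]
        by (simp add: a_minus_def RR.M.r_neg[simplified])
      ultimately have "y \<ominus>\<^bsub>M\<^esub> a \<in> F m"
        by (auto simp: F_def le_Suc_eq) (metis le_antisym not_less_eq_eq)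
      then obtain b where b: "b \<in> H \<inter> K" "\<And>j. c j (y \<ominus>\<^bsub>M\<^esub> a \<ominus>\<^bsub>M\<^esub> b) = \<zero>\<^bsub>R\<^esub>"
        using Suc.IH by blast
      have bM: "b \<in> carrier M" using b(1) submodule_carrier[OF K] by auto
      have "y \<ominus>\<^bsub>M\<^esub> a \<ominus>\<^bsub>M\<^esub> b = y \<ominus>\<^bsub>M\<^esub> (a \<oplus>\<^bsub>M\<^esub> b)"
        using yM aM bM by (simp add: a_minus_def M.minus_add M.M.a_assoc)
      moreover have "a \<oplus>\<^bsub>M\<^esub> b \<in> H \<inter> K"
        using a b(1) K' submodule_add[OF K] submodule_add[OF H(1)] by blast
      ultimately show ?case using b(2) by metis
    qed
    moreover obtain m where "x \<in> F m" using c_fin[OF x] x by (auto simp: F_def)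
    ultimately obtain a where a: "a \<in> H \<inter> K" "\<And>j. c j (x \<ominus>\<^bsub>M\<^esub> a) = \<zero>\<^bsub>R\<^esub>" by blast
    then have "\<forall>b\<in>U. \<phi> b (x \<ominus>\<^bsub>M\<^esub> a) = \<zero>\<^bsub>R\<^esub>" using c_\<phi> by metis
    then show "\<exists>a\<in>H \<inter> K. \<forall>b\<in>U. \<phi> b (x \<ominus>\<^bsub>M\<^esub> a) = \<zero>\<^bsub>R\<^esub>" using a(1) by blast
  qed
qed

section \<open>Quotients and unions of complexes\<close>

text \<open>In \<open>is_filtration\<close> the cokernels have the same element type as the stages,
  so cosets as sets of elements would be of the wrong type.\<close>

lemma quotient_module:
  fixes R :: "'r ring" and Y :: "('r, 'm) module"
  assumes Y: "left_module R Y" and A: "submodule A R Y"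
  obtains C :: "('r, 'm) module" and g where "left_module R C" "g \<in> lmod_hom R Y C"
    "g ` carrier Y = carrier C" "\<And>y. y \<in> carrier Y \<Longrightarrow> g y = \<zero>\<^bsub>C\<^esub> \<longleftrightarrow> y \<in> A"
proof -
  interpret Y: left_module R Y by fact
  \<comment> \<open>choosing coset representatives keeps the quotient on the type of \<open>Y\<close>\<close>
  define g where "g y = (SOME z. z \<in> carrier Y \<and> z \<ominus>\<^bsub>Y\<^esub> y \<in> A)" for y
  have g: "g y \<in> carrier Y \<and> g y \<ominus>\<^bsub>Y\<^esub> y \<in> A" if "y \<in> carrier Y" for y
    unfolding g_def by (rule someI[of _ y]) (use that submodule_zero[OF A] in \<open>simp add: Y.diff_self\<close>)
  \<comment> \<open>Congruent elements have the same candidates for a representative, so the choice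
    operator returns the same one.\<close>
  have g_eq: "g x = g y" if "x \<in> carrier Y" "y \<in> carrier Y" "x \<ominus>\<^bsub>Y\<^esub> y \<in> A" for x y
  proof -
    have "z \<ominus>\<^bsub>Y\<^esub> x \<in> A \<longleftrightarrow> z \<ominus>\<^bsub>Y\<^esub> y \<in> A" if z: "z \<in> carrier Y" for z
    proof -
      have eq: "z \<ominus>\<^bsub>Y\<^esub> y = (z \<ominus>\<^bsub>Y\<^esub> x) \<oplus>\<^bsub>Y\<^esub> (x \<ominus>\<^bsub>Y\<^esub> y)"
        "z \<ominus>\<^bsub>Y\<^esub> x = (z \<ominus>\<^bsub>Y\<^esub> y) \<ominus>\<^bsub>Y\<^esub> (x \<ominus>\<^bsub>Y\<^esub> y)"
        using z \<open>x \<in> carrier Y\<close> \<open>y \<in> carrier Y\<close>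
        by (simp_all add: a_minus_def Y.minus_add Y.M.a_assoc Y.M.r_neg1 Y.M.a_comm[of "\<ominus>\<^bsub>Y\<^esub> x" y])
      show ?thesis
        using eq submodule_add[OF A _ \<open>x \<ominus>\<^bsub>Y\<^esub> y \<in> A\<close>] Y.submodule_minus[OF A _ \<open>x \<ominus>\<^bsub>Y\<^esub> y \<in> A\<close>] by metis
    qed
    then show ?thesis unfolding g_def by meson
  qed
  define C :: "('r, 'm) module" where "C = \<lparr>carrier = g ` carrier Y, monoid.mult = undefined, one = undefined,
      zero = g \<zero>\<^bsub>Y\<^esub>, add = (\<lambda>u v. g (u \<oplus>\<^bsub>Y\<^esub> v)), smult = (\<lambda>a u. g (a \<odot>\<^bsub>Y\<^esub> u))\<rparr>"
  have g_add: "g (x \<oplus>\<^bsub>Y\<^esub> y) = g (g x \<oplus>\<^bsub>Y\<^esub> g y)" if "x \<in> carrier Y" "y \<in> carrier Y" for x y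
  proof (rule g_eq[symmetric])
    have "(g x \<oplus>\<^bsub>Y\<^esub> g y) \<ominus>\<^bsub>Y\<^esub> (x \<oplus>\<^bsub>Y\<^esub> y) = (g x \<ominus>\<^bsub>Y\<^esub> x) \<oplus>\<^bsub>Y\<^esub> (g y \<ominus>\<^bsub>Y\<^esub> y)"
      using g that by (simp add: a_minus_def Y.minus_add Y.M.a_ac)
    then show "(g x \<oplus>\<^bsub>Y\<^esub> g y) \<ominus>\<^bsub>Y\<^esub> (x \<oplus>\<^bsub>Y\<^esub> y) \<in> A"
      using submodule_add[OF A] g that by simp
  qed (use g that in auto)
  have g_smult: "g (a \<odot>\<^bsub>Y\<^esub> x) = g (a \<odot>\<^bsub>Y\<^esub> g x)" if "a \<in> carrier R" "x \<in> carrier Y" for a x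
  proof (rule g_eq[symmetric])
    have "\<ominus>\<^bsub>Y\<^esub> (a \<odot>\<^bsub>Y\<^esub> x) = a \<odot>\<^bsub>Y\<^esub> (\<ominus>\<^bsub>Y\<^esub> x)"
      using that Y.smult_r_distr[of a "\<ominus>\<^bsub>Y\<^esub> x" x] by (simp add: Y.M.l_neg Y.M.minus_equality)
    then have "a \<odot>\<^bsub>Y\<^esub> g x \<ominus>\<^bsub>Y\<^esub> a \<odot>\<^bsub>Y\<^esub> x = a \<odot>\<^bsub>Y\<^esub> (g x \<ominus>\<^bsub>Y\<^esub> x)"
      using g that by (simp add: a_minus_def Y.smult_r_distr)
    then show "a \<odot>\<^bsub>Y\<^esub> g x \<ominus>\<^bsub>Y\<^esub> a \<odot>\<^bsub>Y\<^esub> x \<in> A"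
      using submodule_smult[OF A] g that by simp
  qed (use g that in auto)
  have "left_module R C" "g \<in> lmod_hom R Y C"
    by (rule left_module_image[OF Y]; simp add: C_def g_add[symmetric] g_smult[symmetric])+
  moreover have "g y = \<zero>\<^bsub>C\<^esub> \<longleftrightarrow> y \<in> A" if y: "y \<in> carrier Y" for y
  proof
    assume "g y = \<zero>\<^bsub>C\<^esub>"
    then have "g y \<in> A" using g[of "\<zero>\<^bsub>Y\<^esub>"] by (auto simp: C_def Y.diff_zero)
    moreover have "y = g y \<ominus>\<^bsub>Y\<^esub> (g y \<ominus>\<^bsub>Y\<^esub> y)"
      using g[OF y] y by (simp add: a_minus_def Y.minus_add Y.M.r_neg2)
    ultimately show "y \<in> A" using Y.submodule_minus[OF A, of "g y" "g y \<ominus>\<^bsub>Y\<^esub> y"] g[OF y] by simp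
  next
    assume "y \<in> A"
    then show "g y = \<zero>\<^bsub>C\<^esub>" using y by (auto simp: C_def Y.diff_zero intro: g_eq)
  qed
  moreover have "g ` carrier Y = carrier C" by (simp add: C_def)
  ultimately show thesis using that by blast
qed

lemma quotient_complex:
  fixes R :: "'r ring" and Y :: "('r, 'm) chain_complex"
  assumes Y: "chain_complex R Y" and A: "\<And>m. submodule (A m) R (term_at Y m)"
    and bdry: "\<And>m. bdry Y m ` A m \<subseteq> A (m - 1)"
  obtains C :: "('r, 'm) chain_complex" and g where "chain_complex R C" "chain_map R Y C g"
    "\<And>m. g m ` carrier (term_at Y m) = carrier (term_at C m)"
    "\<And>m y. y \<in> carrier (term_at Y m) \<Longrightarrow> g m y = \<zero>\<^bsub>term_at C m\<^esub> \<longleftrightarrow> y \<in> A m"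
proof -
  have Ym: "left_module R (term_at Y m)" and bY: "bdry Y m \<in> lmod_hom R (term_at Y m) (term_at Y (m - 1))" for m
    using Y by (auto simp: chain_complex_def)
  have "\<forall>m. \<exists>C :: ('r, 'm) module. \<exists>g. left_module R C \<and> g \<in> lmod_hom R (term_at Y m) C \<and>
    g ` carrier (term_at Y m) = carrier C \<and> (\<forall>y\<in>carrier (term_at Y m). g y = \<zero>\<^bsub>C\<^esub> \<longleftrightarrow> y \<in> A m)"
    using quotient_module[OF Ym A] by metis
  then obtain C :: "int \<Rightarrow> ('r, 'm) module" and g where C: "\<And>m. left_module R (C m)"
    and g: "\<And>m. g m \<in> lmod_hom R (term_at Y m) (C m)" and surj: "\<And>m. g m ` carrier (term_at Y m) = carrier (C m)"
    and ker: "\<And>m y. y \<in> carrier (term_at Y m) \<Longrightarrow> g m y = \<zero>\<^bsub>C m\<^esub> \<longleftrightarrow> y \<in> A m"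
    by metis
  have "\<exists>G. G \<in> lmod_hom R (C m) (C (m - 1)) \<and> (\<forall>y\<in>carrier (term_at Y m). G (g m y) = g (m - 1) (bdry Y m y))" for m
  proof (rule lmod_hom_factor[OF Ym C C g[of m] surj, of "\<lambda>y. g (m - 1) (bdry Y m y)" "m - 1"])
    show "(\<lambda>y. g (m - 1) (bdry Y m y)) \<in> lmod_hom R (term_at Y m) (C (m - 1))"
      by (rule lmod_hom_comp[OF bY g])
    fix y assume "y \<in> carrier (term_at Y m)" "g m y = \<zero>\<^bsub>C m\<^esub>"
    then have "bdry Y m y \<in> A (m - 1)" using ker bdry by blast
    then show "g (m - 1) (bdry Y m y) = \<zero>\<^bsub>C (m - 1)\<^esub>"
      using ker submodule_carrier[OF A] by blast
  qed auto
  then obtain G where G: "\<And>m. G m \<in> lmod_hom R (C m) (C (m - 1))"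
    and Gg: "\<And>m y. y \<in> carrier (term_at Y m) \<Longrightarrow> G m (g m y) = g (m - 1) (bdry Y m y)"
    by metis
  show thesis
  proof (rule that[of "\<lparr>term_at = C, bdry = G\<rparr>" g])
    have "G (m - 1) (G m u) = \<zero>\<^bsub>C (m - 2)\<^esub>" if "u \<in> carrier (C m)" for m u
    proof -
      obtain y where y: "y \<in> carrier (term_at Y m)" "u = g m y" using \<open>u \<in> _\<close> surj by blast
      have b: "bdry Y m y \<in> carrier (term_at Y (m - 1))" using lmod_hom_closed[OF bY y(1)] .
      have "G (m - 1) (G m u) = g (m - 2) (bdry Y (m - 1) (bdry Y m y))"
        using Gg[OF y(1)] Gg[OF b] y(2) by simp
      also have "\<dots> = g (m - 2) \<zero>\<^bsub>term_at Y (m - 2)\<^esub>"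
        using Y y(1) by (simp add: chain_complex_def)
      finally show ?thesis using lmod_hom_pair.zero[OF lmod_hom_pairI[OF Ym C g]] by simp
    qed
    then show "chain_complex R \<lparr>term_at = C, bdry = G\<rparr>" using C G by (simp add: chain_complex_def)
    show "chain_map R Y \<lparr>term_at = C, bdry = G\<rparr> g" using g Gg by (simp add: chain_map_def)
  qed (use surj ker in auto)
qed

text \<open>Of two stages one contains the other, so the maps of a cocone agree wherever their
  domains overlap and glue to one map on the union. Applied at the limit indices and to
  \<open>X\<close> itself.\<close>

lemma is_colimit_Union:
  fixes R :: "'r ring" and X :: "('r, 'm) chain_complex" and D :: "'i \<Rightarrow> ('r, 'm) chain_complex"
  assumes X: "chain_complex R X" and D: "\<And>\<alpha>. \<alpha> \<in> A \<Longrightarrow> chain_complex R (D \<alpha>)"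
    and term_D: "\<And>\<alpha> m. \<alpha> \<in> A \<Longrightarrow> term_at (D \<alpha>) m = (term_at X m)\<lparr>carrier := c \<alpha> m\<rparr>"
    and bdry: "\<And>\<alpha>. \<alpha> \<in> A \<Longrightarrow> bdry (D \<alpha>) = bdry X"
    and total: "\<And>\<alpha> \<beta>. \<alpha> \<in> A \<Longrightarrow> \<beta> \<in> A \<Longrightarrow> (\<alpha>, \<beta>) \<in> r \<or> (\<beta>, \<alpha>) \<in> r"
    and mono: "\<And>\<alpha> \<beta> m. \<alpha> \<in> A \<Longrightarrow> \<beta> \<in> A \<Longrightarrow> (\<alpha>, \<beta>) \<in> r \<Longrightarrow> c \<alpha> m \<subseteq> c \<beta> m"
    and union: "\<And>m. carrier (term_at X m) = (\<Union>\<alpha>\<in>A. c \<alpha> m)"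
  shows "is_colimit R r A D (\<lambda>_ _ _ x. x) X (\<lambda>_ _ x. x)"
  unfolding is_colimit_def
proof (intro conjI allI impI)
  show "cocone R r A D (\<lambda>_ _ _ x. x) X (\<lambda>_ _ x. x)"
    using X union by (auto simp: cocone_def chain_map_def chain_map_eq_def lmod_hom_def term_D bdry)
  fix Y :: "('r, ('i \<times> 'm) set) chain_complex" and \<phi>
  assume Y: "cocone R r A D (\<lambda>_ _ _ x. x) Y \<phi>"
  have \<phi>: "\<phi> \<alpha> m \<in> lmod_hom R (term_at (D \<alpha>) m) (term_at Y m)" if "\<alpha> \<in> A" for \<alpha> m
    using Y that by (auto simp: cocone_def chain_map_def)
  have \<phi>_bdry: "\<phi> \<alpha> (m - 1) (bdry X m x) = bdry Y m (\<phi> \<alpha> m x)" if "\<alpha> \<in> A" "x \<in> c \<alpha> m" for \<alpha> m x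
    using Y that bdry[OF that(1)] by (auto simp: cocone_def chain_map_def term_D)
  have \<phi>_eq: "\<phi> \<alpha> m x = \<phi> \<beta> m x" if "\<alpha> \<in> A" "\<beta> \<in> A" "x \<in> c \<alpha> m" "x \<in> c \<beta> m" for \<alpha> \<beta> m x
    using Y total[OF that(1,2)] that by (auto simp: cocone_def chain_map_eq_def term_D)
  define h where "h m x = \<phi> (SOME \<alpha>. \<alpha> \<in> A \<and> x \<in> c \<alpha> m) m x" for m x
  have h: "h m x = \<phi> \<alpha> m x" if "\<alpha> \<in> A" "x \<in> c \<alpha> m" for \<alpha> m x
  proof -
    have "(SOME \<alpha>. \<alpha> \<in> A \<and> x \<in> c \<alpha> m) \<in> A \<and> x \<in> c (SOME \<alpha>. \<alpha> \<in> A \<and> x \<in> c \<alpha> m) m"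
      using that by (intro someI[of "\<lambda>\<alpha>. \<alpha> \<in> A \<and> x \<in> c \<alpha> m"]) simp
    then show ?thesis unfolding h_def using \<phi>_eq that by blast
  qed
  have D_closed: "x \<oplus>\<^bsub>term_at X m\<^esub> y \<in> c \<alpha> m" "a \<odot>\<^bsub>term_at X m\<^esub> x \<in> c \<alpha> m"
    "bdry X m x \<in> c \<alpha> (m - 1)"
    if "\<alpha> \<in> A" "x \<in> c \<alpha> m" "y \<in> c \<alpha> m" "a \<in> carrier R" for \<alpha> m x y a
  proof -
    interpret left_module R "term_at (D \<alpha>) m" using D[OF that(1)] by (simp add: chain_complex_def)
    show "x \<oplus>\<^bsub>term_at X m\<^esub> y \<in> c \<alpha> m" "a \<odot>\<^bsub>term_at X m\<^esub> x \<in> c \<alpha> m"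
      using M.a_closed[of x y] smult_closed[of a x] that by (simp_all add: term_D)
    show "bdry X m x \<in> c \<alpha> (m - 1)"
      using D[OF that(1)] that lmod_hom_closed[of "bdry X m" R "term_at (D \<alpha>) m" "term_at (D \<alpha>) (m - 1)" x]
      by (simp add: chain_complex_def bdry term_D)
  qed
  \<comment> \<open>Additivity of the glued map can be checked in one stage that contains both
    summands.\<close>
  have common: "\<exists>\<alpha>\<in>A. x \<in> c \<alpha> m \<and> y \<in> c \<alpha> m"
    if xy: "x \<in> carrier (term_at X m)" "y \<in> carrier (term_at X m)" for m x y
  proof -
    obtain \<alpha> \<beta> where "\<alpha> \<in> A" "x \<in> c \<alpha> m" "\<beta> \<in> A" "y \<in> c \<beta> m" using xy by (auto simp: union)
    then show ?thesis using total[of \<alpha> \<beta>] mono[of \<alpha> \<beta> m] mono[of \<beta> \<alpha> m] by blast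
  qed
  have ring: "ring R" using X by (auto simp: chain_complex_def left_module_def)
  have "chain_map R X Y h"
    unfolding chain_map_def
  proof (intro conjI allI ballI lmod_homI)
    fix m x assume "x \<in> carrier (term_at X m)"
    then obtain \<alpha> where \<alpha>: "\<alpha> \<in> A" "x \<in> c \<alpha> m" by (auto simp: union)
    show "h m x \<in> carrier (term_at Y m)"
      using lmod_hom_closed[OF \<phi>[OF \<alpha>(1)]] \<alpha> by (simp add: h term_D)
    show "h (m - 1) (bdry X m x) = bdry Y m (h m x)"
      using D_closed(3)[OF \<alpha> \<alpha>(2), of "\<zero>\<^bsub>R\<^esub>"] ring.ring_simprules(2)[OF ring] \<phi>_bdry[OF \<alpha>] \<alpha>
      by (simp add: h)
    show "h m (a \<odot>\<^bsub>term_at X m\<^esub> x) = a \<odot>\<^bsub>term_at Y m\<^esub> h m x" if "a \<in> carrier R" for a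
      using D_closed(2)[OF \<alpha> \<alpha>(2) that] lmod_hom_smult[OF \<phi>[OF \<alpha>(1), of m] that, of x] \<alpha>
      by (simp add: h term_D)
  next
    fix m x y assume "x \<in> carrier (term_at X m)" "y \<in> carrier (term_at X m)"
    then obtain \<alpha> where \<alpha>: "\<alpha> \<in> A" "x \<in> c \<alpha> m" "y \<in> c \<alpha> m" using common by blast
    show "h m (x \<oplus>\<^bsub>term_at X m\<^esub> y) = h m x \<oplus>\<^bsub>term_at Y m\<^esub> h m y"
      using D_closed(1)[OF \<alpha>, of "\<zero>\<^bsub>R\<^esub>"] ring.ring_simprules(2)[OF ring]
        lmod_hom_add[OF \<phi>[OF \<alpha>(1), of m], of x y] \<alpha>
      by (simp add: h term_D)
  qed
  moreover have "chain_map_eq X h h'" if "\<forall>\<alpha>\<in>A. chain_map_eq (D \<alpha>) (\<lambda>m x. h' m x) (\<phi> \<alpha>)" for h'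
    using that by (auto simp: chain_map_eq_def union term_D h)
  ultimately show "\<exists>h. chain_map R X Y h \<and> (\<forall>\<alpha>\<in>A. chain_map_eq (D \<alpha>) (\<lambda>m x. h m x) (\<phi> \<alpha>)) \<and>
      (\<forall>h'. chain_map R X Y h' \<and> (\<forall>\<alpha>\<in>A. chain_map_eq (D \<alpha>) (\<lambda>m x. h' m x) (\<phi> \<alpha>)) \<longrightarrow>
        chain_map_eq X h h')"
    by (intro exI[of _ h]) (auto simp: chain_map_eq_def term_D h)
qed

section \<open>Resolved complexes\<close>

text \<open>The map \<open>\<tau>\<close> lifts the boundary of \<open>X\<close> elementwise, with
  no linearity assumed. It is only applied to dual basis elements, and from these the consequences
  spread to submodules by \<open>part_subset\<close>.\<close>

locale resolved_complex =
  fixes R :: "'r ring" and n :: nat and X :: "('r, 'm) chain_complex"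
    and P :: "int \<Rightarrow> nat \<Rightarrow> ('r, 'p) module" and d :: "int \<Rightarrow> nat \<Rightarrow> 'p \<Rightarrow> 'p" and \<epsilon> :: "int \<Rightarrow> 'p \<Rightarrow> 'm"
    and \<phi> :: "int \<Rightarrow> nat \<Rightarrow> 'p \<Rightarrow> 'p \<Rightarrow> 'r" and \<tau> :: "int \<Rightarrow> 'p \<Rightarrow> 'p"
  assumes noeth: "left_noetherian R" and complex: "chain_complex R X"
    and resolution: "\<And>m. exact_resolution R n (P m) (d m) (\<epsilon> m) (term_at X m)"
    and basis: "\<And>m k. dual_basis R (P m k) (carrier (P m k)) (\<lambda>b. b) (\<phi> m k)"
    and lift_closed: "\<And>m x. x \<in> carrier (P m 0) \<Longrightarrow> \<tau> m x \<in> carrier (P (m - 1) 0)"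
    and lift: "\<And>m x. x \<in> carrier (P m 0) \<Longrightarrow> \<epsilon> (m - 1) (\<tau> m x) = bdry X m (\<epsilon> m x)"
begin

lemma P_module: "left_module R (P m k)"
  and X_module: "left_module R (term_at X m)"
  and d_hom: "d m k \<in> lmod_hom R (P m (Suc k)) (P m k)"
  and \<epsilon>_hom: "\<epsilon> m \<in> lmod_hom R (P m 0) (term_at X m)"
  and \<epsilon>_surj: "\<epsilon> m ` carrier (P m 0) = carrier (term_at X m)"
  and bdry_hom: "bdry X m \<in> lmod_hom R (term_at X m) (term_at X (m - 1))"
  using resolution[of m] complex by (simp_all add: exact_resolution_def chain_complex_def)

lemma d_pair: "lmod_hom_pair R (P m (Suc k)) (P m k) (d m k)"
  by (intro lmod_hom_pairI P_module d_hom)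

lemma \<epsilon>_pair: "lmod_hom_pair R (P m 0) (term_at X m) (\<epsilon> m)"
  by (intro lmod_hom_pairI P_module X_module \<epsilon>_hom)

lemma bdry_pair: "lmod_hom_pair R (term_at X m) (term_at X (m - 1)) (bdry X m)"
  by (intro lmod_hom_pairI X_module bdry_hom)

lemma basis_module: "dual_basis_module R (P m k) (carrier (P m k)) (\<lambda>b. b) (\<phi> m k)"
  by (intro dual_basis_moduleI P_module basis)

section \<open>Selections of dual basis indices and the submodules they determine\<close>

text \<open>A set of triples \<open>(m, k, b)\<close> selects indices \<open>b\<close> of the dual bases of all \<open>P m k\<close> at once.\<close>

definition supp :: "int \<Rightarrow> nat \<Rightarrow> 'p \<Rightarrow> (int \<times> nat \<times> 'p) set" where
  "supp m k x = (\<lambda>b. (m, k, b)) ` {b \<in> carrier (P m k). \<phi> m k b x \<noteq> \<zero>\<^bsub>R\<^esub>}"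

lemma finite_supp: "x \<in> carrier (P m k) \<Longrightarrow> finite (supp m k x)"
  unfolding supp_def by (intro finite_imageI dual_basis_module.finite_support[OF basis_module])

definition part :: "int \<Rightarrow> nat \<Rightarrow> (int \<times> nat \<times> 'p) set \<Rightarrow> 'p set" where
  "part m k J = {x \<in> carrier (P m k). supp m k x \<subseteq> J}"

lemma part_eq_supported:
  "part m k J = dual_basis_module.supported R (P m k) (carrier (P m k)) (\<phi> m k) {b. (m, k, b) \<in> J}"
  unfolding dual_basis_module.supported_def[OF basis_module] by (auto simp: part_def supp_def)

lemma part_iff: "x \<in> part m k J \<longleftrightarrow> x \<in> carrier (P m k) \<and> supp m k x \<subseteq> J"
  by (simp add: part_def)

lemma submodule_part: "submodule (part m k J) R (P m k)"
  unfolding part_eq_supported by (rule dual_basis_module.submodule_supported[OF basis_module])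

text \<open>By the dual basis expansion, a property that defines a submodule holds on
  \<open>part m k J\<close> once it holds for the dual basis elements selected by
  \<open>J\<close>.\<close>

lemma part_subset:
  "submodule H R (P m k) \<Longrightarrow> (\<And>b. b \<in> carrier (P m k) \<Longrightarrow> (m, k, b) \<in> J \<Longrightarrow> b \<in> H) \<Longrightarrow> part m k J \<subseteq> H"
  unfolding part_eq_supported by (rule dual_basis_module.supported_subset[OF basis_module]) auto

lemma part_mono: "J \<subseteq> K \<Longrightarrow> part m k J \<subseteq> part m k K"
  by (auto simp: part_def)

lemma part_closed: "x \<in> part m k J \<Longrightarrow> x \<in> carrier (P m k)"
  by (simp add: part_def)

text \<open>Supports are finite, so a support covered by the union of a chain is covered by one
  member.\<close>

lemma part_Union_chain:
  assumes x: "x \<in> part m k (\<Union>\<J>)" and "\<J> \<noteq> {}" and "\<And>J K. J \<in> \<J> \<Longrightarrow> K \<in> \<J> \<Longrightarrow> J \<subseteq> K \<or> K \<subseteq> J"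
  obtains J where "J \<in> \<J>" "x \<in> part m k J"
proof -
  have "subset.chain UNIV \<J>" using assms(3) by (auto simp: subset.chain_def subset_eq psubset_eq)
  moreover have "finite (supp m k x)" "supp m k x \<subseteq> \<Union>\<J>" using x finite_supp by (auto simp: part_iff)
  ultimately obtain J where "J \<in> \<J>" "supp m k x \<subseteq> J"
    using finite_subset_Union_chain \<open>\<J> \<noteq> {}\<close> by metis
  then show thesis using that x by (auto simp: part_iff)
qed

text \<open>Each index forces only finitely many others. The support of \<open>b\<close> itself puts
  \<open>b\<close> into the selected part, the support of its differential makes the parts a
  subcomplex of the resolution, and in degree 0 the support of \<open>\<tau> m b\<close> makes their
  images in \<open>X\<close> stable under the boundary.\<close>

definition requires :: "(int \<times> nat \<times> 'p) rel" where
  "requires = {((m, k, b), v). b \<in> carrier (P m k) \<and>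
     v \<in> supp m k b \<union> (case k of 0 \<Rightarrow> supp (m - 1) 0 (\<tau> m b) | Suc j \<Rightarrow> supp m j (d m j b))}"

lemma countable_requires_Image:
  assumes "countable Y"
  shows "countable (requires `` Y)"
proof -
  have "countable (requires `` {u})" for u
  proof -
    obtain m k b where u: "u = (m, k, b)" by (cases u)
    have "finite (requires `` {u})"
    proof (cases "b \<in> carrier (P m k)")
      case True
      then have "requires `` {u} = supp m k b \<union> (case k of 0 \<Rightarrow> supp (m - 1) 0 (\<tau> m b) | Suc j \<Rightarrow> supp m j (d m j b))"
        by (auto simp: requires_def u)
      then show ?thesis
        using True lift_closed lmod_hom_closed[OF d_hom] by (auto simp: finite_supp split: nat.split)
    next
      case False
      then have "requires `` {u} = {}" by (auto simp: requires_def u)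
      then show ?thesis by simp
    qed
    then show ?thesis by (rule countable_finite)
  qed
  moreover have "requires `` Y = (\<Union>u\<in>Y. requires `` {u})" by auto
  ultimately show ?thesis using assms by simp
qed

definition closed :: "(int \<times> nat \<times> 'p) set \<Rightarrow> bool" where
  "closed J \<longleftrightarrow> requires `` J \<subseteq> J"

lemma closed_Union: "(\<And>J. J \<in> \<J> \<Longrightarrow> closed J) \<Longrightarrow> closed (\<Union>\<J>)"
  by (auto simp: closed_def)

lemma closed_closure: "closed (requires\<^sup>* `` E)"
  by (auto simp: closed_def intro: rtrancl_into_rtrancl)

text \<open>Enlarging a closed set by \<open>E\<close> costs no more than the closure of
  \<open>E\<close>. So a countable enlargement stays countable relative to the old set, however
  large that is.\<close>

lemma closure_Un:
  assumes "closed J"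
  shows "requires\<^sup>* `` (J \<union> E) = J \<union> requires\<^sup>* `` E"
proof -
  have "v \<in> J" if "(u, v) \<in> requires\<^sup>*" "u \<in> J" for u v
    using that assms by induction (auto simp: closed_def)
  then show ?thesis by (auto simp: Image_Un)
qed

lemma countable_closure: "countable E \<Longrightarrow> countable (requires\<^sup>* `` E)"
  by (rule countable_rtrancl[OF countable_requires_Image])

context
  fixes J
  assumes J: "closed J"
begin

lemma basis_in_part: "b \<in> carrier (P m k) \<Longrightarrow> (m, k, b) \<in> J \<Longrightarrow> b \<in> part m k J"
proof -
  assume b: "b \<in> carrier (P m k)" "(m, k, b) \<in> J"
  then have "supp m k b \<subseteq> requires `` J" by (force simp: requires_def)
  then show ?thesis using b J by (auto simp: closed_def part_iff)
qed

lemma d_part: "d m k ` part m (Suc k) J \<subseteq> part m k J"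
proof -
  have "part m (Suc k) J \<subseteq> {x \<in> carrier (P m (Suc k)). d m k x \<in> part m k J}"
  proof (rule part_subset)
    show "submodule {x \<in> carrier (P m (Suc k)). d m k x \<in> part m k J} R (P m (Suc k))"
      by (rule lmod_hom_pair.submodule_vimage[OF d_pair submodule_part])
    fix b assume b: "b \<in> carrier (P m (Suc k))" "(m, Suc k, b) \<in> J"
    then have "supp m k (d m k b) \<subseteq> requires `` J" by (force simp: requires_def)
    then show "b \<in> {x \<in> carrier (P m (Suc k)). d m k x \<in> part m k J}"
      using b J lmod_hom_closed[OF d_hom] by (auto simp: closed_def part_iff)
  qed
  then show ?thesis by auto
qed

text \<open>The elements of \<open>P m 0\<close> whose image has its boundary in the right-hand side
  form a submodule, so dual basis elements suffice; for these \<open>\<tau>\<close> supplies the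
  preimage.\<close>

lemma bdry_part: "bdry X m ` \<epsilon> m ` part m 0 J \<subseteq> \<epsilon> (m - 1) ` part (m - 1) 0 J"
proof -
  let ?T = "{y \<in> carrier (term_at X m). bdry X m y \<in> \<epsilon> (m - 1) ` part (m - 1) 0 J}"
  let ?S = "{x \<in> carrier (P m 0). \<epsilon> m x \<in> ?T}"
  have "part m 0 J \<subseteq> ?S"
  proof (rule part_subset)
    show "submodule ?S R (P m 0)"
      by (intro lmod_hom_pair.submodule_vimage[OF \<epsilon>_pair] lmod_hom_pair.submodule_vimage[OF bdry_pair]
        lmod_hom_pair.submodule_image[OF \<epsilon>_pair] submodule_part)
    fix b assume b: "b \<in> carrier (P m 0)" "(m, 0, b) \<in> J"
    then have "supp (m - 1) 0 (\<tau> m b) \<subseteq> requires `` J" by (force simp: requires_def)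
    then have "\<tau> m b \<in> part (m - 1) 0 J"
      using b J lift_closed by (auto simp: closed_def part_iff)
    then have "bdry X m (\<epsilon> m b) \<in> \<epsilon> (m - 1) ` part (m - 1) 0 J"
      using lift[OF b(1)] by (metis imageI)
    then show "b \<in> ?S" using b lmod_hom_closed[OF \<epsilon>_hom] by auto
  qed
  then show ?thesis by auto
qed

end

section \<open>The subcomplexes of \<open>X\<close> given by selections, and good selections\<close>

definition stage :: "(int \<times> nat \<times> 'p) set \<Rightarrow> ('r, 'm) chain_complex" where
  "stage J = \<lparr>term_at = (\<lambda>m. (term_at X m)\<lparr>carrier := \<epsilon> m ` part m 0 J\<rparr>), bdry = bdry X\<rparr>"

lemma submodule_stage: "submodule (\<epsilon> m ` part m 0 J) R (term_at X m)"
  by (rule lmod_hom_pair.submodule_image[OF \<epsilon>_pair submodule_part])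

lemma stage_module: "left_module R (term_at (stage J) m)"
  using left_module_restrict[OF X_module submodule_stage] by (simp add: stage_def)

lemma stage_mono: "J \<subseteq> K \<Longrightarrow> \<epsilon> m ` part m 0 J \<subseteq> \<epsilon> m ` part m 0 K"
  using part_mono by blast

lemma stage_complex:
  assumes "closed J"
  shows "chain_complex R (stage J)"
  unfolding chain_complex_def
proof (intro conjI allI ballI)
  show "left_module R (term_at (stage J) m)" for m by (rule stage_module)
  note sub = submodule_carrier[OF submodule_stage]
  show "bdry (stage J) m \<in> lmod_hom R (term_at (stage J) m) (term_at (stage J) (m - 1))" for m
    using lmod_hom_restrict[OF bdry_hom _ bdry_part[OF assms], of m] sub
    by (auto simp: stage_def)
  fix m x assume "x \<in> carrier (term_at (stage J) m)"
  then have "x \<in> carrier (term_at X m)" using sub by (simp add: stage_def)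
  then show "bdry (stage J) (m - 1) (bdry (stage J) m x) = \<zero>\<^bsub>term_at (stage J) (m - 2)\<^esub>"
    using complex by (simp add: stage_def chain_complex_def)
qed

text \<open>Cycles of the selected part are boundaries in the full resolution. The second condition
  asks that they be boundaries within the part, so that the parts resolve the terms of
  \<open>stage J\<close>.\<close>

definition good :: "(int \<times> nat \<times> 'p) set \<Rightarrow> bool" where
  "good J \<longleftrightarrow> closed J \<and>
     (\<forall>m k. part m k J \<inter> d m k ` carrier (P m (Suc k)) \<subseteq> d m k ` part m (Suc k) J)"

lemma part_empty: "part m k {} = {\<zero>\<^bsub>P m k\<^esub>}"
proof -
  interpret left_module R "P m k" by (rule P_module)
  have "submodule {\<zero>\<^bsub>P m k\<^esub>} R (P m k)" by (rule submoduleI) auto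
  then have "part m k {} \<subseteq> {\<zero>\<^bsub>P m k\<^esub>}" by (rule part_subset) auto
  then show ?thesis using submodule_zero[OF submodule_part] by fastforce
qed

lemma good_empty: "good {}"
  by (auto simp: good_def closed_def part_empty lmod_hom_pair.zero[OF d_pair])

text \<open>Exactness is tested on one element at a time, and that element already lies in the part
  of one member of the chain.\<close>

lemma good_Union:
  assumes "\<And>J. J \<in> \<J> \<Longrightarrow> good J" and chain: "\<And>J K. J \<in> \<J> \<Longrightarrow> K \<in> \<J> \<Longrightarrow> J \<subseteq> K \<or> K \<subseteq> J"
  shows "good (\<Union>\<J>)"
proof (cases "\<J> = {}")
  \<comment> \<open>The empty family occurs at the least index of the filtration.\<close>
  case True
  then show ?thesis using good_empty by simp
next
  case False
  have "x \<in> d m k ` part m (Suc k) (\<Union>\<J>)"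
    if x: "x \<in> part m k (\<Union>\<J>)" "x \<in> d m k ` carrier (P m (Suc k))" for m k x
  proof -
    obtain J where J: "J \<in> \<J>" "x \<in> part m k J" using part_Union_chain[OF x(1) False chain] .
    then have "x \<in> d m k ` part m (Suc k) J" using x(2) J(2) assms(1)[OF J(1)] unfolding good_def by blast
    then show ?thesis using part_mono[of J "\<Union>\<J>" m "Suc k"] J(1) by blast
  qed
  then show ?thesis
    using closed_Union[of \<J>] assms(1) by (auto simp: good_def)
qed

text \<open>Let \<open>?Z\<close> be the boundaries in \<open>part m k K\<close>. Those with
  vanishing coordinates at \<open>K - J\<close> lie in \<open>part m k J\<close>, where goodness of
  \<open>J\<close> gives preimages. Modulo these, countably many elements of \<open>?Z\<close>
  suffice by \<open>noetherian_countable_generation\<close>, applied to the countably many forms at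
  \<open>K - J\<close>. \<open>W\<close> collects the supports of preimages of these
  elements.\<close>

lemma exactness_witnesses:
  assumes J: "good J" and "J \<subseteq> K" and "countable (K - J)"
  obtains W where "countable W"
    "\<And>L. K \<union> W \<subseteq> L \<Longrightarrow> part m k K \<inter> d m k ` carrier (P m (Suc k)) \<subseteq> d m k ` part m (Suc k) L"
proof -
  interpret d: lmod_hom_pair R "P m (Suc k)" "P m k" "d m k" by (rule d_pair)
  interpret B: dual_basis_module R "P m k" "carrier (P m k)" "\<lambda>b. b" "\<phi> m k" by (rule basis_module)
  let ?Z = "part m k K \<inter> d m k ` carrier (P m (Suc k))"
  have "submodule (carrier (P m (Suc k))) R (P m (Suc k))" by (rule d.M.submoduleI) auto
  then have Z: "submodule ?Z R (P m k)"
    by (intro submodule_Int P_module submodule_part d.submodule_image)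
  let ?U = "{b \<in> carrier (P m k). (m, k, b) \<in> K - J}"
  have "countable ((\<lambda>b. (m, k, b)) ` ?U)"
    by (rule countable_subset[OF _ assms(3)]) auto
  then have U: "countable ?U" by (rule countable_image_inj_on) (auto simp: inj_on_def)
  have fin: "finite {b \<in> ?U. \<phi> m k b x \<noteq> \<zero>\<^bsub>R\<^esub>}" if "x \<in> ?Z" for x
  proof -
    have "x \<in> carrier (P m k)" using that part_closed by blast
    from B.finite_support[OF this] show ?thesis by (rule rev_finite_subset) auto
  qed
  obtain A where A: "countable A" "A \<subseteq> ?Z"
    and gen: "\<And>x H. x \<in> ?Z \<Longrightarrow> submodule H R (P m k) \<Longrightarrow> A \<subseteq> H \<Longrightarrow>
      \<exists>a\<in>H \<inter> ?Z. \<forall>b\<in>?U. \<phi> m k b (x \<ominus>\<^bsub>P m k\<^esub> a) = \<zero>\<^bsub>R\<^esub>"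
    using noetherian_countable_generation[OF noeth P_module Z U B.form_hom fin]
    by (metis (no_types, lifting) mem_Collect_eq)
  have "\<forall>a\<in>A. \<exists>w\<in>carrier (P m (Suc k)). d m k w = a" using A(2) by blast
  then obtain w where w: "\<And>a. a \<in> A \<Longrightarrow> w a \<in> carrier (P m (Suc k))" "\<And>a. a \<in> A \<Longrightarrow> d m k (w a) = a"
    by metis
  show thesis
  proof
    show "countable (\<Union>a\<in>A. supp m (Suc k) (w a))"
      using A(1) w(1) by (intro countable_UN) (auto intro: countable_finite finite_supp)
    fix L assume L: "K \<union> (\<Union>a\<in>A. supp m (Suc k) (w a)) \<subseteq> L"
    let ?H = "d m k ` part m (Suc k) L"
    have H: "submodule ?H R (P m k)" by (intro d.submodule_image submodule_part)
    have "A \<subseteq> ?H"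
    proof
      fix a assume a: "a \<in> A"
      then have "w a \<in> part m (Suc k) L" using w(1) L by (auto simp: part_iff)
      then show "a \<in> ?H" using w(2)[OF a] by (metis imageI)
    qed
    show "?Z \<subseteq> ?H"
    proof
      fix x assume x: "x \<in> ?Z"
      obtain a where a: "a \<in> ?H" "a \<in> ?Z" and xa: "\<And>b. b \<in> ?U \<Longrightarrow> \<phi> m k b (x \<ominus>\<^bsub>P m k\<^esub> a) = \<zero>\<^bsub>R\<^esub>"
        using gen[OF x H \<open>A \<subseteq> ?H\<close>] by auto
      have diff: "x \<ominus>\<^bsub>P m k\<^esub> a \<in> ?Z" using d.N.submodule_minus[OF Z x a(2)] .
      then have "x \<ominus>\<^bsub>P m k\<^esub> a \<in> part m k J"
        using xa by (auto simp: part_iff supp_def)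
      then have "x \<ominus>\<^bsub>P m k\<^esub> a \<in> d m k ` part m (Suc k) J" using diff J unfolding good_def by blast
      also have "\<dots> \<subseteq> ?H" using L assms(2) by (intro image_mono part_mono) auto
      finally have "x \<ominus>\<^bsub>P m k\<^esub> a \<oplus>\<^bsub>P m k\<^esub> a \<in> ?H" using submodule_add[OF H] a(1) by blast
      then show "x \<in> ?H"
        using submodule_carrier[OF Z x] submodule_carrier[OF H a(1)]
        by (simp add: a_minus_def d.N.M.a_assoc d.N.M.l_neg)
    qed
  qed
qed

text \<open>Rounds of adding witnesses and closing up: boundaries from \<open>part m k (K i)\<close>
  obtain preimages in the next set \<open>K (Suc i)\<close>. An element of the part of the union
  occurs in some round, so exactness holds in the union.\<close>

lemma good_extension:
  assumes J: "good J" and E: "countable E"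
  obtains K where "good K" "J \<subseteq> K" "E \<subseteq> K" "countable (K - J)"
proof -
  define cond where "cond K \<longleftrightarrow> J \<subseteq> K \<and> E \<subseteq> K \<and> closed K \<and> countable (K - J)" for K
  have cl: "\<exists>K'. K \<union> E' \<subseteq> K' \<and> closed K' \<and> countable (K' - J)"
    if "closed K" "countable (K - J)" "countable E'" for K E'
  proof -
    have "countable (requires\<^sup>* `` (K \<union> E') - J)"
      unfolding closure_Un[OF that(1)]
      by (rule countable_subset[of _ "(K - J) \<union> requires\<^sup>* `` E'"])
        (use that countable_closure in auto)
    then show ?thesis by (intro exI[of _ "requires\<^sup>* `` (K \<union> E')"]) (auto simp: closed_closure)
  qed
  have start: "\<exists>K. cond K"
    using cl[of J E] J E by (auto simp: cond_def good_def)
  have step: "\<exists>K'. cond K' \<and> K \<subseteq> K' \<and>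
      (\<forall>m k. part m k K \<inter> d m k ` carrier (P m (Suc k)) \<subseteq> d m k ` part m (Suc k) K')"
    if K: "cond K" for K
  proof -
    \<comment> \<open>Witnesses are always taken relative to the good set \<open>J\<close>, since
      the intermediate sets \<open>K\<close> are closed but need not be good.\<close>
    have "\<exists>W. countable W \<and> (\<forall>L. K \<union> W \<subseteq> L \<longrightarrow>
        part m k K \<inter> d m k ` carrier (P m (Suc k)) \<subseteq> d m k ` part m (Suc k) L)" for m k
      using exactness_witnesses[OF J, of K m k] K unfolding cond_def by metis
    then obtain W where W: "\<And>m k. countable (W m k)"
      "\<And>m k L. K \<union> W m k \<subseteq> L \<Longrightarrow>
        part m k K \<inter> d m k ` carrier (P m (Suc k)) \<subseteq> d m k ` part m (Suc k) L"
      by metis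
    have "countable (\<Union>m k. W m k)" using W(1) by simp
    from cl[OF _ _ this, of K] K obtain K' where
      K': "K \<union> (\<Union>m k. W m k) \<subseteq> K'" "closed K'" "countable (K' - J)"
      by (auto simp: cond_def)
    have KW: "K \<union> W m k \<subseteq> K'" for m k using K'(1) by blast
    have KK': "K \<subseteq> K'" using K'(1) by blast
    have "cond K'" using K K' KK' unfolding cond_def by (metis order_trans)
    then show ?thesis using KK' W(2)[OF KW] by (intro exI[of _ K'] conjI allI)
  qed
  obtain K where K: "\<And>i::nat. cond (K i)" "\<And>i. K i \<subseteq> K (Suc i)"
    "\<And>i m k. part m k (K i) \<inter> d m k ` carrier (P m (Suc k)) \<subseteq> d m k ` part m (Suc k) (K (Suc i))"
    using dependent_nat_choice[of "\<lambda>_. cond" "\<lambda>_ K K'. K \<subseteq> K' \<and>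
      (\<forall>m k. part m k K \<inter> d m k ` carrier (P m (Suc k)) \<subseteq> d m k ` part m (Suc k) K')"] start step
    by metis
  have chain: "A \<subseteq> B \<or> B \<subseteq> A" if "A \<in> range K" "B \<in> range K" for A B
    using that lift_Suc_mono_le[of K, OF K(2)] by (metis imageE nat_le_linear)
  have "good (\<Union>(range K))"
    unfolding good_def
  proof (intro conjI allI subsetI)
    show "closed (\<Union>(range K))" using K(1) by (intro closed_Union) (auto simp: cond_def)
    fix m k x assume x: "x \<in> part m k (\<Union>(range K)) \<inter> d m k ` carrier (P m (Suc k))"
    then obtain J where "J \<in> range K" "x \<in> part m k J"
      using part_Union_chain[of x m k "range K"] chain by (metis IntD1 UNIV_not_empty image_is_empty)
    then obtain i where "x \<in> part m k (K i)" by blast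
    then have "x \<in> d m k ` part m (Suc k) (K (Suc i))" using K(3) x by blast
    then show "x \<in> d m k ` part m (Suc k) (\<Union>(range K))"
      using part_mono[of "K (Suc i)" "\<Union>(range K)"] by blast
  qed
  moreover have "countable (\<Union>i. K i - J)"
    by (intro countable_UN) (use K(1) in \<open>auto simp: cond_def\<close>)
  then have "countable (\<Union>(range K) - J)"
    by (rule countable_subset[rotated]) auto
  moreover have "J \<subseteq> \<Union>(range K)" "E \<subseteq> \<Union>(range K)" using K(1) by (auto simp: cond_def)
  ultimately show thesis using that by blast
qed


text \<open>In degree \<open>k\<close> the part of \<open>K\<close> modulo the part of
  \<open>J\<close> is the coordinate module at the countable set \<open>?U k\<close>. It has a
  countable dual basis, so it is projective and countably generated. By
  \<open>exact_resolution_quotient\<close> these modules resolve \<open>C\<close>.\<close>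

lemma quotient_in_class:
  assumes J: "good J" and K: "good K" and "J \<subseteq> K" and "countable (K - J)"
    and C: "left_module R C" and g: "g \<in> lmod_hom R (term_at (stage K) m) C"
    and surj: "g ` \<epsilon> m ` part m 0 K = carrier C"
    and ker: "\<And>y. y \<in> \<epsilon> m ` part m 0 K \<Longrightarrow> g y = \<zero>\<^bsub>C\<^esub> \<longleftrightarrow> y \<in> \<epsilon> m ` part m 0 J"
  shows "proj_dim_le_aleph0 R n C"
proof -
  let ?B = "\<lambda>k. {b. (m, k, b) \<in> K}" and ?U = "\<lambda>k. {b \<in> carrier (P m k). (m, k, b) \<in> K - J}"
  have U: "countable (?U k)" "?U k \<subseteq> carrier (P m k)" "?U k \<subseteq> ?B k" for k
  proof -
    have "countable ((\<lambda>b. (m, k, b)) ` ?U k)"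
      by (rule countable_subset[OF _ assms(4)]) auto
    then show "countable (?U k)" by (rule countable_image_inj_on) (auto simp: inj_on_def)
  qed auto
  define \<kappa> where "\<kappa> k = dual_basis_module.coordinates R (\<phi> m k) (?U k)" for k
  define Q where "Q k = dual_basis_module.coordinate_module R (P m k) (carrier (P m k)) (\<phi> m k) (?U k) (?B k)" for k
  have partB: "part m k K = dual_basis_module.supported R (P m k) (carrier (P m k)) (\<phi> m k) (?B k)" for k
    by (rule part_eq_supported)
  have partA: "part m k J = dual_basis_module.supported R (P m k) (carrier (P m k)) (\<phi> m k) (?B k - ?U k)" for k
    unfolding dual_basis_module.supported_def[OF basis_module]
    using \<open>J \<subseteq> K\<close> by (auto simp: part_iff supp_def image_subset_iff subset_iff)
  have Q: "left_module R (Q k)" and \<kappa>: "\<kappa> k \<in> lmod_hom R ((P m k)\<lparr>carrier := part m k K\<rparr>) (Q k)"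
    and \<kappa>_ker: "\<And>x. x \<in> part m k K \<Longrightarrow> \<kappa> k x = \<zero>\<^bsub>Q k\<^esub> \<longleftrightarrow> x \<in> part m k J" for k
    unfolding Q_def \<kappa>_def partA partB
    using dual_basis_module.left_module_coordinate[OF basis_module U]
      dual_basis_module.coordinates_hom[OF basis_module U]
      dual_basis_module.coordinates_eq_zero_iff[OF basis_module U] by blast+
  have \<kappa>_surj: "\<kappa> k ` part m k K = carrier (Q k)" for k
    unfolding Q_def \<kappa>_def partB dual_basis_module.coordinate_module_def[OF basis_module] by simp
  have cl: "closed J" "closed K" using J K by (auto simp: good_def)
  have Q_basis: "\<exists>q \<psi>. dual_basis_module R (Q k) (?U k) q \<psi>" for k
  proof -
    have 1: "b \<in> part m k K" if "b \<in> carrier (P m k)" "b \<in> ?B k" for b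
      using basis_in_part[OF cl(2)] that by auto
    have 2: "b \<in> part m k J" if "b \<in> carrier (P m k)" "b \<in> ?B k - ?U k" for b
      using basis_in_part[OF cl(1)] that by auto
    show ?thesis
      using dual_basis_moduleI[OF Q[unfolded Q_def] dual_basis_module.coordinate_dual_basis[OF basis_module U
          1[unfolded partB] 2[unfolded partA]]]
      unfolding Q_def by blast
  qed
  have Q_class: "projective_lmod R (Q k)" "countably_generated R (Q k)" for k
    using Q_basis[of k] dual_basis_module.projective dual_basis_module.countably_generated[OF _ U(1)]
    by blast+
  \<comment> \<open>One countably generated projective per degree is enough; the class asks for a
    direct sum, so it becomes a sum over the index set {0}, isomorphic to \<open>Q k\<close> via
    \<open>?w\<close>.\<close>
  let ?S = "\<lambda>k. lmod_direct_sum {0::nat} (\<lambda>_. Q k)" and ?w = "\<lambda>u. \<lambda>i\<in>{0::nat}. u"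
  have S: "left_module R (?S k)" "?w \<in> lmod_hom R (Q k) (?S k)" "?w ` carrier (Q k) = carrier (?S k)"
    and w_zero: "?w u = \<zero>\<^bsub>?S k\<^esub> \<longleftrightarrow> u = \<zero>\<^bsub>Q k\<^esub>" for k u
  proof -
    have "x \<in> ?w ` carrier (Q k)" if "x \<in> carrier (?S k)" for x
    proof
      show "x = ?w (x 0)" using that by (auto simp: lmod_direct_sum_def PiE_def extensional_def fun_eq_iff)
      show "x 0 \<in> carrier (Q k)" using that by (auto simp: lmod_direct_sum_def)
    qed
    then show *: "?w ` carrier (Q k) = carrier (?S k)"
      by (auto simp: lmod_direct_sum_def)
    show "left_module R (?S k)" "?w \<in> lmod_hom R (Q k) (?S k)"
      by (rule left_module_image[OF Q *]; auto simp: lmod_direct_sum_def fun_eq_iff)+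
    show "?w u = \<zero>\<^bsub>?S k\<^esub> \<longleftrightarrow> u = \<zero>\<^bsub>Q k\<^esub>"
      by (auto simp: lmod_direct_sum_def fun_eq_iff)
  qed
  have "\<exists>d' \<epsilon>'. exact_resolution R n ?S d' \<epsilon>' C"
  proof (rule exact_resolution_quotient[OF resolution submodule_part submodule_part part_mono[OF \<open>J \<subseteq> K\<close>]
      d_part[OF cl(1)] d_part[OF cl(2)] _ _ S(1) lmod_hom_comp[OF \<kappa> S(2)] _ _ C _ surj ker])
    show "part m k J \<inter> d m k ` carrier (P m (Suc k)) \<subseteq> d m k ` part m (Suc k) J"
      "part m k K \<inter> d m k ` carrier (P m (Suc k)) \<subseteq> d m k ` part m (Suc k) K" for k
      using J K by (auto simp only: good_def)
    show "(\<lambda>x. ?w (\<kappa> k x)) ` part m k K = carrier (?S k)" for k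
      unfolding S(3)[symmetric] \<kappa>_surj[symmetric] by (simp add: image_image)
    show "?w (\<kappa> k x) = \<zero>\<^bsub>?S k\<^esub> \<longleftrightarrow> x \<in> part m k J" if "x \<in> part m k K" for k x
      using w_zero \<kappa>_ker[OF that] by simp
    show "g \<in> lmod_hom R ((term_at X m)\<lparr>carrier := \<epsilon> m ` part m 0 K\<rparr>) C"
      using g by (simp add: stage_def)
  qed
  then show ?thesis
    unfolding proj_dim_le_aleph0_def using Q_class
    by (intro exI[of _ "\<lambda>_. {0::nat}"] exI[of _ "\<lambda>k _. Q k"]) auto
qed

lemma stage_quotient:
  assumes J: "good J" and K: "good K" and "J \<subseteq> K" and "countable (K - J)"
  shows "\<exists>(C :: ('r, 'm) chain_complex) g. dw R (proj_dim_le_aleph0 R n) C \<and> short_exact R (stage J) (\<lambda>_ x. x) (stage K) g C"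
proof -
  have cl: "closed J" "closed K" using J K by (auto simp: good_def)
  have sub: "submodule (\<epsilon> m ` part m 0 J) R (term_at (stage K) m)" for m
    using stage_mono[OF \<open>J \<subseteq> K\<close>, of m] submodule_stage[of m J]
      submodule_zero[OF submodule_stage, of m J] submodule_add[OF submodule_stage, of _ m J]
      submodule_smult[OF submodule_stage, of _ _ m J]
    by (intro left_module.submoduleI stage_module) (auto simp: stage_def)
  have bdry: "bdry (stage K) m ` \<epsilon> m ` part m 0 J \<subseteq> \<epsilon> (m - 1) ` part (m - 1) 0 J" for m
    using bdry_part[OF cl(1)] by (simp add: stage_def)
  obtain C :: "('r, 'm) chain_complex" and g where C: "chain_complex R C" "chain_map R (stage K) C g"
    and surj: "\<And>m. g m ` carrier (term_at (stage K) m) = carrier (term_at C m)"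
    and ker: "\<And>m y. y \<in> carrier (term_at (stage K) m) \<Longrightarrow>
      g m y = \<zero>\<^bsub>term_at C m\<^esub> \<longleftrightarrow> y \<in> \<epsilon> m ` part m 0 J"
    using quotient_complex[OF stage_complex[OF cl(2)] sub bdry] by blast
  have "proj_dim_le_aleph0 R n (term_at C m)" for m
    using quotient_in_class[OF assms, of "term_at C m" "g m" m] C surj[of m] ker[of _ m]
    by (auto simp: chain_complex_def chain_map_def stage_def)
  then have "dw R (proj_dim_le_aleph0 R n) C" using C by (simp add: dw_def)
  moreover have "short_exact R (stage J) (\<lambda>_ x. x) (stage K) g C"
    unfolding short_exact_def
  proof (intro conjI allI C stage_complex cl surj)
    show "chain_map R (stage J) (stage K) (\<lambda>_ x. x)"
      using stage_mono[OF \<open>J \<subseteq> K\<close>] by (auto simp: chain_map_def lmod_hom_def stage_def)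
    show "lmod_ker (term_at (stage K) m) (term_at C m) (g m) = (\<lambda>x. x) ` carrier (term_at (stage J) m)" for m
      using ker[of _ m] stage_mono[OF \<open>J \<subseteq> K\<close>, of m] by (simp add: lmod_ker_def stage_def) blast
  qed (auto simp: inj_on_def)
  ultimately show ?thesis by blast
qed

text \<open>The zero complex belongs to the class as the quotient of the empty selection by
  itself.\<close>

lemma stage_empty: "dw R (proj_dim_le_aleph0 R n) (stage {})"
proof -
  have "proj_dim_le_aleph0 R n (term_at (stage {}) m)" for m
    by (rule quotient_in_class[OF good_empty good_empty _ _ stage_module, of "\<lambda>x. x"])
      (auto simp: lmod_hom_def stage_def part_empty lmod_hom_pair.zero[OF \<epsilon>_pair])
  then show ?thesis
    using stage_complex[of "{}"] by (simp add: dw_def closed_def)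
qed

section \<open>Transfinite construction of the filtration\<close>

text \<open>The seed of \<open>\<alpha>\<close> enters in the step from \<open>\<alpha>\<close> to its successor, hence no last index is allowed.\<close>

lemma filtration_from_seeds:
  fixes r :: "'i rel" and seed :: "'i \<Rightarrow> (int \<times> nat \<times> 'p) set"
  assumes wo: "Well_order r" and Field: "Field r = UNIV"
    and no_max: "\<And>\<alpha>. \<exists>\<beta>. \<alpha> \<noteq> \<beta> \<and> (\<alpha>, \<beta>) \<in> r"
    and seed_countable: "\<And>\<alpha>. countable (seed \<alpha>)"
    and exhaustive: "\<And>m y. y \<in> carrier (term_at X m) \<Longrightarrow>
      \<exists>\<alpha>. \<forall>J. seed \<alpha> \<subseteq> J \<longrightarrow> y \<in> \<epsilon> m ` part m 0 J"
  shows "\<exists>D f \<iota>. is_filtration R (dw R (proj_dim_le_aleph0 R n)) r D f X \<iota>"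
proof -
  interpret wo: wo_rel r using wo by (simp add: wo_rel_def)
  have lin: "(\<alpha>, \<beta>) \<in> r \<or> (\<beta>, \<alpha>) \<in> r" for \<alpha> \<beta> using wo.TOTALS Field by auto
  \<comment> \<open>The requirement on the set chosen at \<open>\<alpha>\<close>: it is good,
    contains all earlier sets and the seed, and exceeds the union of the earlier sets by countably
    many indices.\<close>
  let ?Q = "\<lambda>f \<alpha> G. good G \<and> (\<Union>(f ` underS r \<alpha>)) \<subseteq> G \<and> seed \<alpha> \<subseteq> G \<and> countable (G - \<Union>(f ` underS r \<alpha>))"
  have Q_good: "good (\<Union>(f ` underS r \<alpha>))" and Q_mono: "\<beta> \<in> underS r \<alpha> \<Longrightarrow> \<gamma> \<in> underS r \<beta> \<Longrightarrow> f \<gamma> \<subseteq> f \<beta>"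
    if "\<And>\<beta>. \<beta> \<in> underS r \<alpha> \<Longrightarrow> ?Q f \<beta> (f \<beta>)" for f \<alpha> \<beta> \<gamma>
  proof -
    show mono: "f \<gamma> \<subseteq> f \<beta>" if "\<beta> \<in> underS r \<alpha>" "\<gamma> \<in> underS r \<beta>" for \<beta> \<gamma>
      using \<open>\<And>\<beta>. \<beta> \<in> underS r \<alpha> \<Longrightarrow> ?Q f \<beta> (f \<beta>)\<close>[OF that(1)] that(2) by blast
    show "good (\<Union>(f ` underS r \<alpha>))"
    proof (rule good_Union)
      show "good J" if "J \<in> f ` underS r \<alpha>" for J
        using \<open>\<And>\<beta>. \<beta> \<in> underS r \<alpha> \<Longrightarrow> ?Q f \<beta> (f \<beta>)\<close> that by blast
      fix J K assume "J \<in> f ` underS r \<alpha>" "K \<in> f ` underS r \<alpha>"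
      then obtain \<beta> \<gamma> where *: "\<beta> \<in> underS r \<alpha>" "J = f \<beta>" "\<gamma> \<in> underS r \<alpha>" "K = f \<gamma>" by auto
      have "\<beta> = \<gamma> \<or> \<beta> \<in> underS r \<gamma> \<or> \<gamma> \<in> underS r \<beta>" using lin[of \<beta> \<gamma>] by (auto simp: underS_def)
      then show "J \<subseteq> K \<or> K \<subseteq> J" using mono * by blast
    qed
  qed
  have "\<exists>f. \<forall>\<alpha>. ?Q f \<alpha> (f \<alpha>)"
  proof (rule dependent_wf_choice[OF wo.WF])
    show "?Q f \<alpha> G = ?Q g \<alpha> G" if "\<And>\<beta>. (\<beta>, \<alpha>) \<in> r - Id \<Longrightarrow> f \<beta> = g \<beta>" for f g \<alpha> G
    proof -
      have "f ` underS r \<alpha> = g ` underS r \<alpha>" using that by (intro image_cong) (auto simp: underS_def)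
      then show ?thesis by simp
    qed
    show "\<exists>G. ?Q f \<alpha> G" if "\<And>\<beta>. (\<beta>, \<alpha>) \<in> r - Id \<Longrightarrow> ?Q f \<beta> (f \<beta>)" for f \<alpha>
    proof -
      have "good (\<Union>(f ` underS r \<alpha>))" by (rule Q_good) (use that in \<open>auto simp: underS_def\<close>)
      then show ?thesis using good_extension[OF _ seed_countable[of \<alpha>]] by metis
    qed
  qed
  then obtain G where G: "\<And>\<alpha>. ?Q G \<alpha> (G \<alpha>)" by blast
  \<comment> \<open>The stages use the union of the strictly earlier sets. So the least stage is
    empty, \<open>V\<close> is continuous at limits, and at the successor of \<open>\<alpha>\<close>
    it equals \<open>G \<alpha>\<close>.\<close>
  define V where "V \<alpha> = \<Union>(G ` underS r \<alpha>)" for \<alpha>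
  have V_good: "good (V \<alpha>)" for \<alpha> unfolding V_def by (rule Q_good) (rule G)
  have VG: "V \<alpha> \<subseteq> G \<alpha>" "countable (G \<alpha> - V \<alpha>)" "seed \<alpha> \<subseteq> G \<alpha>" for \<alpha> using G by (simp_all add: V_def)
  have GV: "G \<alpha> \<subseteq> V \<beta>" if "\<alpha> \<in> underS r \<beta>" for \<alpha> \<beta> using that by (auto simp: V_def)
  have V_mono: "V \<alpha> \<subseteq> V \<beta>" if "(\<alpha>, \<beta>) \<in> r" for \<alpha> \<beta>
    using that VG(1)[of \<alpha>] GV[of \<alpha> \<beta>] by (cases "\<alpha> = \<beta>") (auto simp: underS_def)
  have V_complex: "chain_complex R (stage (V \<alpha>))" for \<alpha>
    using V_good by (intro stage_complex) (simp add: good_def)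
  have stage_map: "chain_map R (stage J) (stage K) (\<lambda>_ x. x)" if "J \<subseteq> K" for J K
    using stage_mono[OF that] by (auto simp: chain_map_def lmod_hom_def stage_def)
  \<comment> \<open>Stages differ only in their carriers, hence identity functions serve as
    transition maps.\<close>
  have "functor_on R r (\<lambda>\<alpha>. stage (V \<alpha>)) (\<lambda>_ _ _ x. x)"
    using V_complex stage_map V_mono by (auto simp: functor_on_def chain_map_eq_def)
  moreover have "dw R (proj_dim_le_aleph0 R n) (stage (V \<alpha>))" if "underS r \<alpha> = {}" for \<alpha>
    using that stage_empty by (simp add: V_def)
  moreover have "\<exists>(C :: ('r, 'm) chain_complex) g. dw R (proj_dim_le_aleph0 R n) C \<and>
      short_exact R (stage (V \<alpha>)) (\<lambda>_ x. x) (stage (V \<beta>)) g C" if "is_succ_of r \<alpha> \<beta>" for \<alpha> \<beta>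
  proof -
    have "G \<gamma> \<subseteq> G \<alpha>" if "\<gamma> \<in> underS r \<beta>" for \<gamma>
    proof (cases "\<gamma> = \<alpha>")
      case False
      then have "\<gamma> \<in> underS r \<alpha>"
        using that \<open>is_succ_of r \<alpha> \<beta>\<close> by (auto simp: is_succ_of_def under_def underS_def)
      then show ?thesis using GV VG(1) by blast
    qed simp
    then have "V \<beta> \<subseteq> G \<alpha>" by (auto simp: V_def)
    then have "V \<beta> = G \<alpha>" using GV that by (auto simp: is_succ_of_def)
    then show ?thesis using stage_quotient[OF V_good V_good, of \<alpha> \<beta>] VG[of \<alpha>] by simp
  qed
  moreover have "is_colimit R r (underS r \<beta>) (\<lambda>\<alpha>. stage (V \<alpha>)) (\<lambda>_ _ _ x. x) (stage (V \<beta>)) (\<lambda>_ _ x. x)"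
    if \<beta>: "underS r \<beta> \<noteq> {}" "\<nexists>\<alpha>. is_succ_of r \<alpha> \<beta>" for \<beta>
  proof (rule is_colimit_Union[where c = "\<lambda>\<alpha> m. \<epsilon> m ` part m 0 (V \<alpha>)"])
    have V_eq: "V \<beta> = \<Union>(V ` underS r \<beta>)"
    proof
      show "V \<beta> \<subseteq> \<Union>(V ` underS r \<beta>)"
      proof
        fix v assume "v \<in> V \<beta>"
        then obtain \<gamma> where \<gamma>: "\<gamma> \<in> underS r \<beta>" "v \<in> G \<gamma>" by (auto simp: V_def)
        \<comment> \<open>As \<open>\<beta>\<close> is not the successor of \<open>\<gamma>\<close>,
          some \<open>\<alpha>\<close> lies strictly between them, and \<open>G \<gamma>\<close> is
          already part of \<open>V \<alpha>\<close>.\<close>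
        have "under r \<gamma> \<subseteq> underS r \<beta>"
          using \<gamma>(1) wo.TRANS wo.ANTISYM unfolding under_def underS_def trans_def antisym_def by blast
        moreover have "underS r \<beta> \<noteq> under r \<gamma>"
          using \<beta>(2) \<gamma>(1) Field by (auto simp: is_succ_of_def)
        ultimately obtain \<alpha> where \<alpha>: "\<alpha> \<in> underS r \<beta>" "(\<alpha>, \<gamma>) \<notin> r" by (auto simp: under_def)
        then have "\<gamma> \<in> underS r \<alpha>" using lin[of \<alpha> \<gamma>] by (auto simp: underS_def)
        then show "v \<in> \<Union>(V ` underS r \<beta>)" using GV \<alpha>(1) \<gamma>(2) by blast
      qed
    qed (use V_mono in \<open>auto simp: underS_def\<close>)
    have chain: "J \<subseteq> K \<or> K \<subseteq> J" if "J \<in> V ` underS r \<beta>" "K \<in> V ` underS r \<beta>" for J K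
      using that lin V_mono by blast
    have "\<exists>\<alpha>\<in>underS r \<beta>. x \<in> part m 0 (V \<alpha>)" if "x \<in> part m 0 (V \<beta>)" for m x
    proof -
      have "V ` underS r \<beta> \<noteq> {}" using \<beta>(1) by simp
      from part_Union_chain[OF that[unfolded V_eq] this chain] show ?thesis by blast
    qed
    moreover have "part m 0 (V \<alpha>) \<subseteq> part m 0 (V \<beta>)" if "\<alpha> \<in> underS r \<beta>" for m \<alpha>
      using that V_mono by (intro part_mono) (auto simp: underS_def)
    ultimately show "carrier (term_at (stage (V \<beta>)) m) = (\<Union>\<alpha>\<in>underS r \<beta>. \<epsilon> m ` part m 0 (V \<alpha>))" for m
      by (fastforce simp: stage_def)
    show "\<epsilon> m ` part m 0 (V \<alpha>) \<subseteq> \<epsilon> m ` part m 0 (V \<gamma>)" if "(\<alpha>, \<gamma>) \<in> r" for \<alpha> \<gamma> m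
      by (rule stage_mono[OF V_mono[OF that]])
  qed (use V_complex lin in \<open>auto simp: stage_def\<close>)
  moreover have "is_colimit R r UNIV (\<lambda>\<alpha>. stage (V \<alpha>)) (\<lambda>_ _ _ x. x) X (\<lambda>_ _ x. x)"
  proof (rule is_colimit_Union[where c = "\<lambda>\<alpha> m. \<epsilon> m ` part m 0 (V \<alpha>)"])
    have "y \<in> (\<Union>\<alpha>. \<epsilon> m ` part m 0 (V \<alpha>))" if y: "y \<in> carrier (term_at X m)" for m y
    proof -
      obtain \<alpha> where \<alpha>: "\<And>J. seed \<alpha> \<subseteq> J \<Longrightarrow> y \<in> \<epsilon> m ` part m 0 J" using exhaustive[OF y] by blast
      obtain \<beta> where "\<alpha> \<noteq> \<beta>" "(\<alpha>, \<beta>) \<in> r" using no_max by blast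
      then have "seed \<alpha> \<subseteq> V \<beta>" using VG(3)[of \<alpha>] GV[of \<alpha> \<beta>] by (auto simp: underS_def)
      then show ?thesis using \<alpha> by blast
    qed
    then show "carrier (term_at X m) = (\<Union>\<alpha>. \<epsilon> m ` part m 0 (V \<alpha>))" for m
      using submodule_carrier[OF submodule_stage] by blast
    show "\<epsilon> m ` part m 0 (V \<alpha>) \<subseteq> \<epsilon> m ` part m 0 (V \<gamma>)" if "(\<alpha>, \<gamma>) \<in> r" for \<alpha> \<gamma> m
      by (rule stage_mono[OF V_mono[OF that]])
  qed (use V_complex lin complex in \<open>auto simp: stage_def\<close>)
  ultimately have "is_filtration R (dw R (proj_dim_le_aleph0 R n)) r (\<lambda>\<alpha>. stage (V \<alpha>)) (\<lambda>_ _ _ x. x) X (\<lambda>_ _ x. x)"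
    using wo unfolding is_filtration_def Field by auto
  then show ?thesis by blast
qed

text \<open>The indices are pairs of a degree and an element; the seed of \<open>(m, y)\<close> is
  the support of a preimage of \<open>y\<close>, so every element of \<open>X\<close> is reached. An
  infinite cardinal as the well-order has no last index.\<close>

lemma has_filtration: "has_filtration R (dw R (proj_dim_le_aleph0 R n)) X"
proof -
  let ?r = "card_of (UNIV :: (int \<times> 'm) set)"
  have Field: "Field ?r = UNIV" and card: "Card_order ?r" by (rule Field_card_of) (rule card_of_Card_order)
  have lifted: "\<exists>x. x \<in> carrier (P m 0) \<and> \<epsilon> m x = y" if "y \<in> carrier (term_at X m)" for m y
    using that unfolding \<epsilon>_surj[symmetric] by auto
  define seed where "seed \<alpha> = (case \<alpha> of (m, y) \<Rightarrow>
    if y \<in> carrier (term_at X m) then supp m 0 (SOME x. x \<in> carrier (P m 0) \<and> \<epsilon> m x = y) else {})" for \<alpha>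
  have "\<exists>D f \<iota>. is_filtration R (dw R (proj_dim_le_aleph0 R n)) ?r D f X \<iota>"
  proof (rule filtration_from_seeds[of _ seed])
    show "Well_order ?r" by (rule card_of_Well_order)
    show "Field ?r = UNIV" by (rule Field)
    \<comment> \<open>The integer component makes the index type infinite even if the terms of
      \<open>X\<close> are finite.\<close>
    have "infinite (UNIV :: (int \<times> 'm) set)" by (simp add: finite_prod)
    then show "\<exists>\<beta>. \<alpha> \<noteq> \<beta> \<and> (\<alpha>, \<beta>) \<in> ?r" for \<alpha>
      using infinite_Card_order_limit[OF card, of \<alpha>] unfolding Field by blast
    show "countable (seed \<alpha>)" for \<alpha>
    proof (cases \<alpha>)
      case (Pair m y)
      then show ?thesis
        using someI_ex[OF lifted[of y m]] finite_supp by (auto simp: seed_def intro!: countable_finite)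
    qed
    fix m y assume y: "y \<in> carrier (term_at X m)"
    define x where "x = (SOME x. x \<in> carrier (P m 0) \<and> \<epsilon> m x = y)"
    have x: "x \<in> carrier (P m 0)" "\<epsilon> m x = y" using someI_ex[OF lifted[OF y]] by (simp_all add: x_def)
    have "seed (m, y) = supp m 0 x" using y by (simp add: seed_def x_def)
    then have "y \<in> \<epsilon> m ` part m 0 J" if "seed (m, y) \<subseteq> J" for J
      using that x by (auto simp: part_iff)
    then show "\<exists>\<alpha>. \<forall>J. seed \<alpha> \<subseteq> J \<longrightarrow> y \<in> \<epsilon> m ` part m 0 J" by blast
  qed
  then show ?thesis unfolding has_filtration_def by blast
qed

end

section \<open>Choice of resolutions, dual bases and lifts of the boundary\<close>

theorem lemma5p1:
  fixes R :: "'r ring" and n :: nat and X :: "('r, 'm) chain_complex"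
  assumes "left_noetherian R" and "n > 0"
    and "dw R (proj_dim_le TYPE('p) R n) X"
  shows "has_filtration R (dw R (proj_dim_le_aleph0 R n)) X"
proof -
  have X: "chain_complex R X" using assms(3) by (simp add: dw_def)
  have "\<forall>m. \<exists>(P :: nat \<Rightarrow> ('r, 'p) module) d \<epsilon>.
      exact_resolution R n P d \<epsilon> (term_at X m) \<and> (\<forall>k\<le>n. projective_lmod R (P k))"
    using assms(3) by (simp add: dw_def proj_dim_le_def)
  then obtain P :: "int \<Rightarrow> nat \<Rightarrow> ('r, 'p) module" and d \<epsilon> where
    res: "\<And>m. exact_resolution R n (P m) (d m) (\<epsilon> m) (term_at X m)"
    and proj: "\<And>m k. k \<le> n \<Longrightarrow> projective_lmod R (P m k)"
    by metis
  have "\<exists>\<phi>. dual_basis R (P m k) (carrier (P m k)) (\<lambda>b. b) \<phi>" for m k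
  proof (cases "k \<le> n")
    case True
    then show ?thesis using projective_dual_basis[OF proj] by blast
  next
    \<comment> \<open>Beyond degree \<open>n\<close> the modules are zero, and zero forms give a
      dual basis: the only expansion is the empty sum.\<close>
    case False
    then have z: "carrier (P m k) = {\<zero>\<^bsub>P m k\<^esub>}" and M: "left_module R (P m k)"
      using res[of m] by (auto simp: exact_resolution_def)
    interpret left_module R "P m k" by (rule M)
    have "dual_basis R (P m k) (carrier (P m k)) (\<lambda>b. b) (\<lambda>_ _. \<zero>\<^bsub>R\<^esub>)"
      by (auto simp: dual_basis_def lmod_hom_def z)
    then show ?thesis by blast
  qed
  then obtain \<phi> where basis: "\<And>m k. dual_basis R (P m k) (carrier (P m k)) (\<lambda>b. b) (\<phi> m k)" by metis
  have "\<exists>x'\<in>carrier (P (m - 1) 0). \<epsilon> (m - 1) x' = bdry X m (\<epsilon> m x)" if "x \<in> carrier (P m 0)" for m x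
  proof -
    have "\<epsilon> m x \<in> carrier (term_at X m)" using res[of m] that by (auto simp: exact_resolution_def)
    then have "bdry X m (\<epsilon> m x) \<in> carrier (term_at X (m - 1))"
      using X lmod_hom_closed by (fastforce simp: chain_complex_def)
    moreover have "\<epsilon> (m - 1) ` carrier (P (m - 1) 0) = carrier (term_at X (m - 1))"
      using res[of "m - 1"] by (simp add: exact_resolution_def)
    ultimately show ?thesis by (metis imageE)
  qed
  then have "\<forall>m. \<exists>\<tau>. \<forall>x\<in>carrier (P m 0).
      \<tau> x \<in> carrier (P (m - 1) 0) \<and> \<epsilon> (m - 1) (\<tau> x) = bdry X m (\<epsilon> m x)"
    by (intro allI bchoice) blast
  then obtain \<tau> where \<tau>: "\<And>m. \<forall>x\<in>carrier (P m 0).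
      \<tau> m x \<in> carrier (P (m - 1) 0) \<and> \<epsilon> (m - 1) (\<tau> m x) = bdry X m (\<epsilon> m x)"
    unfolding choice_iff by blast
  interpret resolved_complex R n X P d \<epsilon> \<phi> \<tau>
    by unfold_locales (use assms(1) X res basis \<tau> in auto)
  show ?thesis by (rule has_filtration)
qed

end
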